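(* Let $n\ge1$, $\beta>0$, and let $h(x)=e^{-\beta|x|^2}$ be the Gaussian function on $\mathbb{R}^n$. Let $b_0>0$ and let $\Omega\subset\mathbb{R}^n$ be a set which can be expressed as the union of rotations and translations of a fixed cube of side $b_0$. Put $\rho=\frac{\sqrt3}{e}$, $$c=\frac{b_0}{8\gamma_n},\qquad C=\left(3^{3/4}\, e\,\sqrt{2\rho\beta}\,\sqrt n\, e^{2n\gamma_n}\right)^4 b_0^{3}\,\gamma_n,\qquad C'=2C,\qquad c'=\frac c2,$$ and $$\triangle''=\begin{cases}\pi^{\frac{n-1}{4}}(n\alpha_n)^{\frac12}\,2^{\frac{n+1}{4}}\left(\frac{\sqrt3}{e}\right)^{\frac{n-2}{4}} & \text{if } n \text{ is even},\\[2mm] \pi^{\frac{n-1}{4}}(n\alpha_n)^{\frac12}\left(2+\frac1e\right)^{\frac12}2^{\frac n4}\left(\frac{\sqrt3}{e}\right)^{\frac{n-1}{4}} & \text{if } n \text{ is odd}.\end{cases}$$ Then there is a positive constant $d_0$ for which the following is true. If $f\in\mathcal{C}_{h,0}$ and $s$ is the $h$ spline that interpolates $f$ on a subset $X$ of $\mathbb{R}^n$, then $$|f(x)-s(x)|\le\triangle''\,[C'd]^{\frac{c'}{d}}\,\|f\|_h$$ holds for all $x$ in a cube $E\subseteq\Omega$ provided that (i) $E$ has side $b$ and $b\ge b_0$, (ii) $0<d\le d_0$, and (iii) every subcube of $E$ of side $2d$ contains a point of $X$. Here $d$ denotes either $d(\Omega,X)$ or $d(E,X)$ (the statement holds for each of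 the two choices).
   Context: The fill distance of a set $X$ in a set $A$ is $d(A,X)=\sup_{y\in A}\inf_{x\in X}|y-x|$. The numbers $\gamma_n$ are defined by $\gamma_1=2$ and $\gamma_n=2n(1+\gamma_{n-1})$ for $n>1$. The number $\alpha_n$ is the volume of the unit ball in $\mathbb{R}^n$. $\mathcal{D}$ denotes the space of complex-valued compactly supported infinitely differentiable functions on $\mathbb{R}^n$. The Gaussian $h$ is conditionally positive definite of order $m=0$ (i.e. positive definite). The space $\mathcal{C}_{h,0}$ is the class of continuous functions $f$ on $\mathbb{R}^n$ for which there is a constant $c(f)$ such that $$\left|\int f(x)\phi(x)\,dx\right|\le c(f)\left\{\iint h(x-y)\phi(x)\overline{\phi(y)}\,dx\,dy\right\}^{1/2}\quad\text{for all }\phi\in\mathcal{D}.$$ For $f\in\mathcal{C}_{h,0}$, $\|f\|_h$ denotes the smallest such constant $c(f)$; with this norm $\mathcal{C}_{h,0}$ is a Hilbert space. Given $f\in\mathcal{C}_{h,0}$ and a subset $X\subset\mathbb{R}^n$, the $h$ spline $s$ that interpolates $f$ on $X$ is the element of $\mathcal{C}_{h,0}$ of minimal norm $\|\cdot\|_h$ that equals $f$ on $X$. When $X=\{x_1,\dots,x_N\}$ is finite, this is the function $s(x)=\sum_{j=1}^N c_j h(x-x_j)$ whose coefficients are determined by $s(x_i)=f(x_i)$, $i=1,\dots,N$. *)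

theory Defs
  imports "HOL-Analysis.Analysis"
begin

text \<open>Values in \<open>ennreal\<close>, so that the distance is infinite, rather than a junk real number,
  when the supremum is unbounded or \<open>X\<close> is empty.\<close>

definition fill_distance :: "'a::real_normed_vector set \<Rightarrow> 'a set \<Rightarrow> ennreal" where
  "fill_distance A X = (SUP y\<in>A. INF x\<in>X. ennreal (norm (y - x)))"

text \<open>The value at \<open>0\<close> is chosen such that the recursion yields \<open>\<gamma>\<^sub>1 = 2\<close>; see \<open>gamma_seq_1\<close>.\<close>

fun gamma_seq :: "nat \<Rightarrow> real" where
  "gamma_seq 0 = 0"
| "gamma_seq (Suc n) = 2 * real (Suc n) * (1 + gamma_seq n)"

lemma gamma_seq_1: "gamma_seq 1 = 2"
  by simp

lemma gamma_seq_rec: "n > 1 \<Longrightarrow> gamma_seq n = 2 * real n * (1 + gamma_seq (n - 1))"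
  by (cases n) simp_all

fun Ck :: "nat \<Rightarrow> ('a::real_normed_vector \<Rightarrow> 'b::real_normed_vector) \<Rightarrow> bool" where
  "Ck 0 f \<longleftrightarrow> continuous_on UNIV f"
| "Ck (Suc k) f \<longleftrightarrow> (\<forall>x. f differentiable (at x)) \<and>
     (\<forall>v. Ck k (\<lambda>x. frechet_derivative f (at x) v))"

definition test_functions :: "(real ^ 'n \<Rightarrow> complex) set" where
  "test_functions = {\<phi>. (\<forall>k. Ck k \<phi>) \<and> compact (closure {x. \<phi> x \<noteq> 0})}"

definition quadratic_form :: "(real ^ 'n \<Rightarrow> real) \<Rightarrow> (real ^ 'n \<Rightarrow> complex) \<Rightarrow> complex" where
  "quadratic_form h \<phi> =
     (LINT y|lborel. LINT x|lborel. complex_of_real (h (x - y)) * \<phi> x * cnj (\<phi> y))"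

text \<open>For positive definite \<open>h\<close> the quadratic form is real and nonnegative, so taking the real
  part only converts the type.\<close>

definition native_bound :: "(real ^ 'n \<Rightarrow> real) \<Rightarrow> (real ^ 'n \<Rightarrow> complex) \<Rightarrow> real \<Rightarrow> bool" where
  "native_bound h f c \<longleftrightarrow> 0 \<le> c \<and>
     (\<forall>\<phi>\<in>test_functions.
        cmod (LINT x|lborel. f x * \<phi> x) \<le> c * sqrt (Re (quadratic_form h \<phi>)))"

definition native_space :: "(real ^ 'n \<Rightarrow> real) \<Rightarrow> (real ^ 'n \<Rightarrow> complex) set" where
  "native_space h = {f. continuous_on UNIV f \<and> (\<exists>c. native_bound h f c)}"

definition native_norm :: "(real ^ 'n \<Rightarrow> real) \<Rightarrow> (real ^ 'n \<Rightarrow> complex) \<Rightarrow> real" where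
  "native_norm h f = (LEAST c. native_bound h f c)"

definition is_spline ::
  "(real ^ 'n \<Rightarrow> real) \<Rightarrow> (real ^ 'n) set \<Rightarrow> (real ^ 'n \<Rightarrow> complex) \<Rightarrow> (real ^ 'n \<Rightarrow> complex) \<Rightarrow> bool"
where
  "is_spline h X f s \<longleftrightarrow> s \<in> native_space h \<and> (\<forall>x\<in>X. s x = f x) \<and>
     (\<forall>g\<in>native_space h. (\<forall>x\<in>X. g x = f x) \<longrightarrow> native_norm h s \<le> native_norm h g)"

text \<open>All rotated and translated copies of the closed cube \<open>[0,b]\<^sup>n\<close>, in every orientation.\<close>

definition cubes :: "real \<Rightarrow> (real ^ 'n) set set" where
  "cubes b = {(\<lambda>x. a + R *v x) ` cbox 0 (\<chi> i. b) | a R. rotation_matrix R}"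

end

theory Submission
  imports Defs "HOL-Complex_Analysis.Conformal_Mappings"
begin

text \<open>
  The error \<open>g = f - s\<close> is continuous, vanishes on \<open>X\<close> and satisfies the native bound with some constant
  \<open>N\<close> at most twice the norm of \<open>f\<close>.
  Testing the native bound on approximate point masses gives
  \<open>\<bar>\<Sum>u. l u * g u\<bar> \<le> N * sqrt (\<Sum>u v. l u * l v * h (u - v))\<close> for finite sums
  (\<open>native_bound_point_evaluations\<close>). Choose \<open>l\<close> as evaluation at \<open>x\<close> minus a
  quadrature formula on points of \<open>X\<close>. The left side then is \<open>\<bar>g x\<bar>\<close> up to a factor at least \<open>1\<close>. The
  Gaussian factors as \<open>exp (- b * \<bar>u\<bar>\<^sup>2) * exp (- b * \<bar>v\<bar>\<^sup>2) * (\<Sum>m. (2 * b * (u \<bullet> v)) ^ m / fact m)\<close>, so if the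
  formula is exact on polynomials of degree below \<open>k\<close>, all terms with \<open>m < k\<close> disappear and the right side is
  of size \<open>const ^ k / sqrt (fact k)\<close> times the size of the coefficients
  (\<open>gaussian_form_annihilator\<close>, \<open>gaussian_zero_set_bound\<close>).

  Quadrature formulas with coefficients at most exponential in \<open>k\<close> exist by finite-dimensional duality
  (\<open>norming_imp_quadrature\<close>) once the points of \<open>X\<close> form a norming set: a polynomial of degree \<open>k\<close> on
  a cube must be bounded by \<open>const ^ k\<close> times its maximum over the points, when there is one point in each
  of \<open>q ^ n\<close> equal cells and \<open>q \<ge> 3 * \<gamma> * k\<close> (\<open>norming_constant\<close>). In dimension one this is Lagrange
  interpolation. In higher dimension the polynomial is multiplied by \<open>(1 - \<bar>x\<bar>\<^sup>2) ^ k\<close>, which forces the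
  maximum over a ball away from the boundary, where a polynomial of degree \<open>3 * k\<close> cannot drop to
  nothing within the diameter of a cell (\<open>norming_ball\<close>, \<open>poly_near_max\<close>).

  With \<open>q\<close> about \<open>b\<^sub>0 / (2 * d)\<close> one may take \<open>k\<close> about \<open>b\<^sub>0 / (6 * \<gamma> * d)\<close>. Then \<open>1 / sqrt (fact k)\<close> decays like
  \<open>d\<close> to the power \<open>b\<^sub>0 / (12 * \<gamma> * d)\<close>, up to factors \<open>const powr (1 / d)\<close>. The exponent
  \<open>c' / d = b\<^sub>0 / (16 * \<gamma> * d)\<close> in the theorem is strictly smaller, so for small \<open>d\<close> the difference absorbs
  all constants (\<open>superexponential_decay\<close>).
\<close>

section \<open>Growth of polynomials in one variable\<close>

lemma power_le_fact_exp:
  fixes x :: real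
  assumes "x \<ge> 0"
  shows "x ^ n \<le> fact n * exp x"
proof -
  have "(\<Sum>n\<in>{n}. x ^ n /\<^sub>R fact n) \<le> exp x"
    unfolding exp_def using assms by (intro sum_le_suminf[OF summable_exp_generic]) auto
  then have "x ^ n / fact n \<le> exp x" by (simp add: field_simps)
  then show ?thesis by (simp add: pos_divide_le_eq mult.commute)
qed

lemma poly_of_real_map_poly:
  "poly (map_poly of_real Q) (of_real x :: complex) = of_real (poly Q x)"
  by (induction Q) (simp_all add: map_poly_pCons)

lemma poly_pderiv_of_real_map_poly:
  "poly (pderiv (map_poly of_real Q)) (of_real x :: complex) = of_real (poly (pderiv Q) x)"
proof (induction Q)
  case (pCons c Q)
  then show ?case by (simp add: map_poly_pCons pderiv_pCons poly_of_real_map_poly)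
qed simp

text \<open>With \<open>x = (z + 1 / z) / 2\<close> the product \<open>z ^ D * Q x\<close> is a polynomial in \<open>z\<close>, and \<open>x\<close> is the
  real number \<open>Re z\<close> when \<open>z\<close> is on the unit circle, so the maximum principle on the unit disc transfers
  the bound on \<open>[-1, 1]\<close> to all complex arguments.\<close>

lemma joukowski_growth:
  fixes Q :: "real poly" and w :: complex
  assumes deg: "degree Q \<le> D" and M: "\<And>t. \<bar>t\<bar> \<le> 1 \<Longrightarrow> \<bar>poly Q t\<bar> \<le> M"
    and w: "w \<noteq> 0" "norm w \<le> 1"
  shows "norm (poly (map_poly of_real Q) ((w + 1 / w) / 2)) \<le> M / norm w ^ D"
proof -
  define G where "G = (\<lambda>z::complex. \<Sum>j\<le>D. of_real (coeff Q j) * (z ^ (D - j) * ((z\<^sup>2 + 1) / 2) ^ j))"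
  have G: "G z = z ^ D * poly (map_poly of_real Q) ((z + 1 / z) / 2)" if "z \<noteq> 0" for z
  proof -
    have "poly (map_poly of_real Q) ((z + 1 / z) / 2)
        = (\<Sum>j\<le>degree Q. of_real (coeff Q j) * ((z + 1 / z) / 2) ^ j)"
      by (simp add: poly_altdef coeff_map_poly degree_map_poly)
    also have "\<dots> = (\<Sum>j\<le>D. of_real (coeff Q j) * ((z + 1 / z) / 2) ^ j)"
      using deg by (intro sum.mono_neutral_left) (auto simp: coeff_eq_0)
    finally have P: "poly (map_poly of_real Q) ((z + 1 / z) / 2)
        = (\<Sum>j\<le>D. of_real (coeff Q j) * ((z + 1 / z) / 2) ^ j)" .
    have e: "z ^ D * ((z + 1 / z) / 2) ^ j = z ^ (D - j) * ((z\<^sup>2 + 1) / 2) ^ j" if "j \<le> D" for j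
    proof -
      have "z ^ D = z ^ (D - j) * z ^ j" using that by (simp flip: power_add)
      moreover have "z * ((z + 1 / z) / 2) = (z\<^sup>2 + 1) / 2" using \<open>z \<noteq> 0\<close>
        by (simp add: field_simps power2_eq_square)
      ultimately show ?thesis by (metis mult.assoc power_mult_distrib)
    qed
    show ?thesis
      unfolding G_def P sum_distrib_left
    proof (rule sum.cong)
      fix j assume "j \<in> {..D}"
      then show "of_real (coeff Q j) * (z ^ (D - j) * ((z\<^sup>2 + 1) / 2) ^ j)
          = z ^ D * (of_real (coeff Q j) * ((z + 1 / z) / 2) ^ j)"
        using e[of j] by (metis atMost_iff mult.left_commute)
    qed simp
  qed
  have "norm (G w) \<le> M"
  proof (rule maximum_modulus_frontier[of G "cball 0 1"])
    show "G holomorphic_on interior (cball 0 1)" unfolding G_def by (intro holomorphic_intros) auto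
    show "continuous_on (closure (cball 0 1)) G" unfolding G_def by (intro continuous_intros) auto
    show "bounded (cball (0::complex) 1)" by simp
    show "w \<in> cball 0 1" using w by simp
    fix z :: complex assume "z \<in> frontier (cball 0 1)"
    then have z: "norm z = 1" by (simp add: frontier_cball)
    then have "z \<noteq> 0" by auto
    have "z * cnj z = 1" using z complex_norm_square[of z] by simp
    then have "1 / z = cnj z" using \<open>z \<noteq> 0\<close> by (simp add: divide_eq_eq mult.commute)
    then have "(z + 1 / z) / 2 = of_real (Re z)" by (simp add: complex_add_cnj)
    moreover have "\<bar>Re z\<bar> \<le> 1" using z abs_Re_le_cmod[of z] by simp
    ultimately have "norm (poly (map_poly of_real Q) ((z + 1 / z) / 2)) \<le> M"
      using M by (simp add: poly_of_real_map_poly)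
    then show "norm (G z) \<le> M" using G[OF \<open>z \<noteq> 0\<close>] z by (simp add: norm_mult norm_power)
  qed
  then have "norm w ^ D * norm (poly (map_poly of_real Q) ((w + 1 / w) / 2)) \<le> M"
    by (simp only: G[OF w(1)] norm_mult norm_power)
  then show ?thesis using w by (subst pos_le_divide_eq) (auto simp: mult.commute)
qed

lemma poly_cos_growth:
  fixes Q :: "real poly" and z :: complex
  assumes deg: "degree Q \<le> D" and M: "\<And>t. \<bar>t\<bar> \<le> 1 \<Longrightarrow> \<bar>poly Q t\<bar> \<le> M"
  shows "norm (poly (map_poly of_real Q) (cos z)) \<le> M * exp (real D * \<bar>Im z\<bar>)"
proof -
  have *: "norm (poly (map_poly of_real Q) (cos z)) \<le> M * exp (real D * Im z)" if "Im z \<ge> 0" for z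
  proof -
    have "norm (exp (\<i> * z)) = exp (- Im z)" by simp
    moreover have "cos z = (exp (\<i> * z) + 1 / exp (\<i> * z)) / 2"
      by (simp add: cos_exp_eq exp_minus inverse_eq_divide)
    moreover have "M / exp (- Im z) ^ D = M * exp (real D * Im z)"
      by (simp add: exp_minus divide_inverse exp_of_nat_mult power_inverse)
    ultimately show ?thesis using joukowski_growth[OF deg M, of "exp (\<i> * z)"] that
      by (metis exp_not_eq_zero exp_le_one_iff neg_le_0_iff_le)
  qed
  show ?thesis
  proof (cases "Im z \<ge> 0")
    case True then show ?thesis using *[of z] by simp
  next
    case False then show ?thesis using *[of "-z"] by simp
  qed
qed

text \<open>On the real axis \<open>y = (w + 1 / w) / 2\<close> with \<open>w = y - sqrt (y\<^sup>2 - 1)\<close>; the growth factor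
  \<open>1 / w = y + sqrt (y\<^sup>2 - 1)\<close> is rounded up to \<open>2 * y\<close>.\<close>

lemma poly_growth_outside:
  fixes Q :: "real poly"
  assumes deg: "degree Q \<le> D" and M: "\<And>t. \<bar>t\<bar> \<le> r \<Longrightarrow> \<bar>poly Q t\<bar> \<le> M" and r: "0 < r" "r \<le> x"
  shows "\<bar>poly Q x\<bar> \<le> M * (2 * x / r) ^ D"
proof -
  define R where "R = pcompose Q [:0, r:]"
  have R: "poly R t = poly Q (r * t)" for t by (simp add: R_def poly_pcompose mult.commute)
  have degR: "degree R \<le> D" unfolding R_def using deg r by (simp add: degree_pcompose)
  define y where "y = x / r"
  have y: "y \<ge> 1" using r by (simp add: y_def)
  define s where "s = sqrt (y\<^sup>2 - 1)"
  have s: "s\<^sup>2 = y\<^sup>2 - 1" "s \<ge> 0" using y by (auto simp: s_def power_mono)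
  have "s \<le> y" using s y by (metis abs_of_nonneg diff_le_eq le_add_same_cancel1 order_trans zero_le_one power2_le_imp_le zero_le_one)
  have prod: "(y + s) * (y - s) = 1" using s by (simp add: algebra_simps power2_eq_square)
  have pos: "y - s > 0" using prod \<open>s \<le> y\<close> by (cases "s = y") auto
  define w where "w = complex_of_real (y - s)"
  have w: "w \<noteq> 0" "norm w = y - s" using pos by (auto simp: w_def simp del: of_real_diff)
  have inv: "1 / (y - s) = y + s" using prod pos by (simp add: field_simps)
  have le1: "y - s \<le> 1"
    using prod s y pos by (smt (verit) mult_less_cancel_right1)
  have "(w + 1 / w) / 2 = of_real ((y - s + 1 / (y - s)) / 2)" by (simp add: w_def)
  also have "\<dots> = of_real y" unfolding inv by simp
  finally have wy: "(w + 1 / w) / 2 = of_real y" .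
  have "norm (poly (map_poly of_real R) ((w + 1 / w) / 2)) \<le> M / norm w ^ D"
    by (rule joukowski_growth[OF degR]) (use M r w le1 in \<open>auto simp: R abs_mult mult_left_le\<close>)
  then have "\<bar>poly R y\<bar> \<le> M / (y - s) ^ D" unfolding wy w by (simp add: poly_of_real_map_poly)
  also have "\<dots> = M * (y + s) ^ D" using inv by (simp add: divide_inverse power_inverse flip: inv)
  also have "\<dots> \<le> M * (2 * y) ^ D"
    using \<open>s \<le> y\<close> s y M[of 0] r by (intro mult_left_mono power_mono) auto
  finally show ?thesis using r by (simp add: R y_def)
qed

lemma exp_nine_fifths_le: "exp (9 / 5 :: real) \<le> 15 / 2"
proof -
  have "exp (9 / 5 :: real) ^ 5 = exp 1 ^ 9" by (simp flip: exp_of_nat_mult)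
  also have "\<dots> \<le> 3 ^ 9" by (intro power_mono exp_le) auto
  also have "\<dots> \<le> (15 / 2) ^ 5" by (simp add: power_divide)
  finally show ?thesis by (subst (asm) power_mono_iff) auto
qed

lemma arccos_diff_le:
  assumes x: "\<bar>x\<bar> < 1" and y: "\<bar>y\<bar> < 1" and s: "s > 0"
    and seg: "\<And>r. r \<in> closed_segment x y \<Longrightarrow> s\<^sup>2 \<le> 1 - r\<^sup>2"
  shows "\<bar>arccos y - arccos x\<bar> \<le> \<bar>y - x\<bar> / s"
proof -
  have "norm (arccos y - arccos x) \<le> 1 / s * norm (y - x)"
  proof (rule differentiable_bound[of "closed_segment x y" _ "\<lambda>r h. h * inverse (- sqrt (1 - r\<^sup>2))"])
    fix r assume r: "r \<in> closed_segment x y"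
    then have "\<bar>r\<bar> < 1" using x y by (auto simp: closed_segment_eq_real_ivl split: if_splits)
    then have "(arccos has_field_derivative inverse (- sqrt (1 - r\<^sup>2))) (at r)"
      by (intro DERIV_arccos) auto
    then show "(arccos has_derivative (\<lambda>h. h * inverse (- sqrt (1 - r\<^sup>2)))) (at r within closed_segment x y)"
      unfolding has_field_derivative_def
      by (rule has_derivative_at_withinI[THEN has_derivative_eq_rhs]) (simp add: fun_eq_iff)
    have "s \<le> \<bar>sqrt (1 - r\<^sup>2)\<bar>" using real_le_rsqrt[OF seg[OF r]] by linarith
    then have "\<bar>inverse (- sqrt (1 - r\<^sup>2))\<bar> \<le> 1 / s" using s
      by (simp add: divide_simps)
    from mult_right_mono[OF this] show "onorm (\<lambda>h. h * inverse (- sqrt (1 - r\<^sup>2))) \<le> 1 / s"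
      by (intro onorm_le) (simp only: real_norm_def abs_mult mult.commute abs_ge_zero)
  qed auto
  then show ?thesis by simp
qed

text \<open>A polynomial cannot drop quickly next to an interior extremum. In the angle variable
  \<open>\<phi> z = Q (cos (a + z * h))\<close> is entire of exponential type \<open>D * \<bar>h\<bar> \<le> 3 / 5\<close>, and \<open>\<phi> z - \<phi> 0\<close> has a double
  zero at \<open>0\<close> because \<open>x\<close> is a critical point. Dividing by \<open>z\<^sup>2\<close> and applying the maximum principle on
  the disc of radius \<open>3\<close> gives \<open>\<bar>\<phi> 1 - \<phi> 0\<bar> \<le> M * (15 / 2 + 1) / 9 = 17 / 18 * M\<close>. The number \<open>s\<close> bounds
  the sine of the angle from below on the segment, which converts distances into angles.\<close>

lemma poly_near_max_unit:
  fixes Q :: "real poly"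
  assumes deg: "degree Q \<le> D" and M: "\<And>t. \<bar>t\<bar> \<le> 1 \<Longrightarrow> \<bar>poly Q t\<bar> \<le> M"
    and x: "\<bar>x\<bar> < 1" and max: "\<bar>poly Q x\<bar> = M" and y: "\<bar>y\<bar> < 1" and s: "s > 0"
    and seg: "\<And>r. r \<in> closed_segment x y \<Longrightarrow> s\<^sup>2 \<le> 1 - r\<^sup>2"
    and near: "real D * \<bar>y - x\<bar> \<le> 3 / 5 * s"
  shows "M \<le> 18 * \<bar>poly Q y\<bar>"
proof -
  have M0: "M \<ge> 0" using max by auto
  define a h where "a = arccos x" and "h = arccos y - arccos x"
  have h: "real D * \<bar>h\<bar> \<le> 3 / 5"
  proof -
    have "real D * \<bar>h\<bar> \<le> real D * (\<bar>y - x\<bar> / s)"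
      unfolding h_def by (intro mult_left_mono arccos_diff_le x y s seg) auto
    also have "\<dots> \<le> 3 / 5" using near s by (simp add: field_simps)
    finally show ?thesis .
  qed
  define \<phi> where "\<phi> = (\<lambda>z::complex. poly (map_poly of_real Q) (cos (of_real a + z * of_real h)))"
  have cos_a: "cos (complex_of_real a) = of_real x" "cos (complex_of_real a + of_real h) = of_real y"
    using x y by (simp_all add: a_def h_def cos_of_real)
  have \<phi>01: "\<phi> 0 = of_real (poly Q x)" "\<phi> 1 = of_real (poly Q y)"
    unfolding \<phi>_def by (simp_all add: cos_a poly_of_real_map_poly)
  have hol: "\<phi> holomorphic_on UNIV"
    unfolding \<phi>_def poly_altdef by (intro holomorphic_intros)
  have growth: "norm (\<phi> z) \<le> M * (15 / 2)" if "norm z \<le> 3" for z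
  proof -
    have "norm (\<phi> z) \<le> M * exp (real D * (\<bar>Im z\<bar> * \<bar>h\<bar>))"
      using poly_cos_growth[OF deg M, of "of_real a + z * of_real h"] by (simp add: \<phi>_def abs_mult)
    also have "real D * (\<bar>Im z\<bar> * \<bar>h\<bar>) = (real D * \<bar>h\<bar>) * \<bar>Im z\<bar>" by simp
    also have "\<dots> \<le> 3 / 5 * 3"
      by (intro mult_mono h) (use that abs_Im_le_cmod[of z] in auto)
    also have "exp (3 / 5 * 3 :: real) \<le> 15 / 2" using exp_nine_fifths_le by simp
    finally show ?thesis using M0 by (simp add: mult_left_mono)
  qed
  have crit: "poly (pderiv Q) x = 0"
  proof -
    define e where "e = 1 - \<bar>x\<bar>"
    have e: "e > 0" using x by (simp add: e_def)
    have near: "\<bar>poly Q z\<bar> \<le> \<bar>poly Q x\<bar>" if "\<bar>x - z\<bar> < e" for z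
      using M[of z] max that by (auto simp: e_def)
    show ?thesis
    proof (cases "poly Q x \<ge> 0")
      case True
      then show ?thesis using near by (intro DERIV_local_max[OF poly_DERIV e]) fastforce
    next
      case False
      then show ?thesis using near by (intro DERIV_local_min[OF poly_DERIV e]) fastforce
    qed
  qed
  have "(\<phi> has_field_derivative of_real (poly (pderiv Q) x) * (- sin (of_real a) * of_real h)) (at 0)"
  proof -
    have "((\<lambda>z::complex. cos (of_real a + z * of_real h)) has_field_derivative - sin (of_real a) * of_real h) (at 0)"
      by (auto intro!: derivative_eq_intros)
    then have "(\<phi> has_field_derivative poly (pderiv (map_poly of_real Q)) (cos (of_real a + 0 * of_real h))
        * (- sin (of_real a) * of_real h)) (at 0)"
      unfolding \<phi>_def by (rule DERIV_chain2[OF poly_DERIV])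
    then show ?thesis by (simp add: cos_a poly_pderiv_of_real_map_poly)
  qed
  then have d0: "deriv \<phi> 0 = 0" using crit by (simp add: DERIV_imp_deriv)
  define g1 where "g1 = (\<lambda>z. if z = 0 then deriv \<phi> 0 else (\<phi> z - \<phi> 0) / (z - 0))"
  have hol1: "g1 holomorphic_on UNIV" unfolding g1_def by (rule pole_lemma[OF hol]) simp
  define g2 where "g2 = (\<lambda>z. if z = 0 then deriv g1 0 else (g1 z - g1 0) / (z - 0))"
  have hol2: "g2 holomorphic_on UNIV" unfolding g2_def by (rule pole_lemma[OF hol1]) simp
  have g2: "g2 z = (\<phi> z - \<phi> 0) / z\<^sup>2" if "z \<noteq> 0" for z
    using that by (simp add: g2_def g1_def d0 power2_eq_square)
  have "norm (g2 1) \<le> M * (17 / 18)"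
  proof (rule maximum_modulus_frontier[of g2 "cball 0 3"])
    show "g2 holomorphic_on interior (cball 0 3)" using hol2 holomorphic_on_subset by blast
    show "continuous_on (closure (cball 0 3)) g2"
      using hol2 holomorphic_on_imp_continuous_on continuous_on_subset by blast
    fix z :: complex assume "z \<in> frontier (cball 0 3)"
    then have z: "norm z = 3" by (simp add: frontier_cball)
    have "norm (g2 z) = norm (\<phi> z - \<phi> 0) / 9" using z g2[of z] by (fastforce simp: norm_divide norm_power)
    also have "\<dots> \<le> (norm (\<phi> z) + norm (\<phi> 0)) / 9" by (simp add: divide_right_mono norm_triangle_ineq4)
    also have "\<dots> \<le> (M * (15 / 2) + M) / 9" using growth[of z] z max by (simp add: \<phi>01)
    finally show "norm (g2 z) \<le> M * (17 / 18)" by simp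
  qed auto
  then have "norm (complex_of_real (poly Q y - poly Q x)) \<le> M * (17 / 18)" using g2[of 1] by (simp add: \<phi>01)
  then show ?thesis using max by (simp only: norm_of_real)
qed

lemma poly_near_max:
  fixes Q :: "real poly"
  assumes deg: "degree Q \<le> D" and M: "\<And>t. \<bar>t\<bar> \<le> A \<Longrightarrow> \<bar>poly Q t\<bar> \<le> M" and A: "A > 0"
    and x: "\<bar>x\<bar> < A" and max: "\<bar>poly Q x\<bar> = M" and y: "\<bar>y\<bar> < A" and s: "s > 0"
    and seg: "\<And>r. r \<in> closed_segment x y \<Longrightarrow> s\<^sup>2 \<le> A\<^sup>2 - r\<^sup>2"
    and near: "real D * \<bar>y - x\<bar> \<le> 3 / 5 * s"
  shows "M \<le> 18 * \<bar>poly Q y\<bar>"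
proof -
  define R where "R = pcompose Q [:0, A:]"
  have R: "poly R t = poly Q (A * t)" for t by (simp add: R_def poly_pcompose mult.commute)
  have "M \<le> 18 * \<bar>poly R (y / A)\<bar>"
  proof (rule poly_near_max_unit[of R D M "x / A" "y / A" "s / A"])
    show "degree R \<le> D" unfolding R_def using deg A by (simp add: degree_pcompose)
    show "\<bar>poly R t\<bar> \<le> M" if "\<bar>t\<bar> \<le> 1" for t
      unfolding R using that A by (intro M) (simp add: abs_mult mult_left_le)
    show "(s / A)\<^sup>2 \<le> 1 - r\<^sup>2" if "r \<in> closed_segment (x / A) (y / A)" for r
    proof -
      have "A * r \<in> closed_segment x y" using that A
        by (auto simp: closed_segment_eq_real_ivl field_simps split: if_splits)
      from seg[OF this] show ?thesis using A by (simp add: field_simps power2_eq_square)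
    qed
    have "\<bar>y / A - x / A\<bar> = \<bar>y - x\<bar> / A" using A by (simp flip: diff_divide_distrib)
    then show "real D * \<bar>y / A - x / A\<bar> \<le> 3 / 5 * (s / A)"
      using near A by (simp add: field_simps)
  qed (use x y s A max in \<open>auto simp: R\<close>)
  then show ?thesis using A by (simp add: R)
qed

section \<open>Norming sets for polynomials\<close>

text \<open>Polynomials in several variables enter the argument only through their restrictions to lines,
  so this replaces the notion of a polynomial of total degree at most \<open>k\<close>.\<close>

definition line_poly :: "nat \<Rightarrow> ('a::real_vector \<Rightarrow> real) \<Rightarrow> bool" where
  "line_poly k p \<longleftrightarrow> (\<forall>a e. \<exists>Q. degree Q \<le> k \<and> (\<forall>t. p (a + t *\<^sub>R e) = poly Q t))"

text \<open>Near the boundary of a domain a polynomial of degree \<open>k\<close> may vary on the scale \<open>1 / k\<^sup>2\<close>, which a net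
  of mesh about \<open>1 / k\<close> cannot resolve. The factor \<open>(1 - \<bar>x\<bar>\<^sup>2) ^ k\<close> removes this problem at the cost of a
  factor exponential in \<open>k\<close>: the damped polynomial \<open>P\<close> takes its maximum \<open>M\<close> over the unit ball at
  distance at least \<open>1 / 10\<close> from the sphere, since its values there are governed by those on the ball of
  radius \<open>3 / 5\<close>. On the chord through the maximum point and a nearby point of the net, \<open>P\<close> is a polynomial
  of degree \<open>3 * k\<close> in one variable with an interior extremum, and so is at least \<open>M / 18\<close> at that
  point of the net.\<close>

lemma norming_ball:
  fixes p :: "'a::euclidean_space \<Rightarrow> real"
  assumes p: "line_poly k p" and cont: "continuous_on UNIV p" and k: "k \<ge> 10"
    and net: "\<And>x. norm x \<le> 9 / 10 \<Longrightarrow> \<exists>y\<in>Y. norm (y - x) \<le> \<delta>" and \<delta>: "real k * \<delta> \<le> 2 / 25"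
    and B: "\<And>y. y \<in> Y \<Longrightarrow> \<bar>p y\<bar> \<le> B" and r: "r \<ge> 1" and u: "norm u \<le> r"
  shows "\<bar>p u\<bar> \<le> 18 * B * (125 / 24 * r) ^ k"
proof -
  define P where "P = (\<lambda>x. p x * (1 - (norm x)\<^sup>2) ^ k)"
  have "continuous_on (cball 0 1) (\<lambda>x. \<bar>P x\<bar>)" unfolding P_def
    by (intro continuous_intros continuous_on_subset[OF cont]) auto
  then obtain x where x: "norm x \<le> 1" and maxx: "\<And>z. norm z \<le> 1 \<Longrightarrow> \<bar>P z\<bar> \<le> \<bar>P x\<bar>"
    using continuous_attains_sup[of "cball (0::'a) 1" "\<lambda>x. \<bar>P x\<bar>"] by auto
  define M where "M = \<bar>P x\<bar>"
  have M0: "M \<ge> 0" by (simp add: M_def)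
  have inner: "\<bar>p z\<bar> \<le> M * (25 / 16) ^ k" if z: "norm z \<le> 3 / 5" for z
  proof -
    have "(norm z)\<^sup>2 \<le> (3 / 5)\<^sup>2" using z by (intro power_mono) auto
    then have "(16 / 25) ^ k \<le> (1 - (norm z)\<^sup>2) ^ k" by (intro power_mono) (auto simp: power2_eq_square)
    then have "(16 / 25) ^ k \<le> \<bar>(1 - (norm z)\<^sup>2) ^ k\<bar>" by linarith
    then have "\<bar>p z\<bar> * (16 / 25) ^ k \<le> \<bar>p z\<bar> * \<bar>(1 - (norm z)\<^sup>2) ^ k\<bar>"
      by (rule mult_left_mono) simp
    also have "\<dots> \<le> M" using maxx[of z] z by (simp add: P_def M_def abs_mult)
    finally have "\<bar>p z\<bar> \<le> M / (16 / 25) ^ k" by (simp add: pos_le_divide_eq)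
    then show ?thesis by (simp add: power_divide)
  qed
  have outer: "\<bar>p z\<bar> \<le> M * (25 / 16) ^ k * (10 / 3 * norm z) ^ k" if z: "norm z \<ge> 3 / 5" for z
  proof -
    have z0: "norm z > 0" using z by linarith
    obtain Q where Q: "degree Q \<le> k" "\<And>t. p (0 + t *\<^sub>R sgn z) = poly Q t"
      using p unfolding line_poly_def by blast
    have "\<bar>poly Q (norm z)\<bar> \<le> M * (25 / 16) ^ k * (2 * norm z / (3 / 5)) ^ k"
    proof (rule poly_growth_outside[OF Q(1)])
      show "\<bar>poly Q t\<bar> \<le> M * (25 / 16) ^ k" if "\<bar>t\<bar> \<le> 3 / 5" for t
        unfolding Q(2)[symmetric] using that z0 by (intro inner) (simp add: norm_sgn)
    qed (use z in auto)
    moreover have "poly Q (norm z) = p z" using Q(2)[of "norm z"] z0 by (simp add: sgn_div_norm)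
    ultimately show ?thesis by (simp add: mult.commute)
  qed
  have "\<bar>p u\<bar> \<le> M * (25 / 16) ^ k * (10 / 3 * r) ^ k"
  proof (cases "norm u \<ge> 3 / 5")
    case True
    have "M * (25 / 16) ^ k * (10 / 3 * norm u) ^ k \<le> M * (25 / 16) ^ k * (10 / 3 * r) ^ k"
      using u M0 by (intro mult_left_mono power_mono) auto
    then show ?thesis using outer[OF True] by linarith
  next
    case False
    have "M * (25 / 16) ^ k * 1 \<le> M * (25 / 16) ^ k * (10 / 3 * r) ^ k"
      using r M0 by (intro mult_left_mono one_le_power) auto
    then show ?thesis using inner[of u] False by simp
  qed
  also have "\<dots> = M * (125 / 24 * r) ^ k"
    unfolding mult.assoc power_mult_distrib[symmetric] by (simp add: field_simps)
  also have "\<dots> \<le> 18 * B * (125 / 24 * r) ^ k"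
  proof (rule mult_right_mono)
    obtain y0 where "y0 \<in> Y" using net[of 0] by auto
    then have B0: "B \<ge> 0" using B by fastforce
    show "M \<le> 18 * B"
    proof (cases "M = 0")
      case True then show ?thesis using B0 by simp
    next
      case False
      then have Mpos: "M > 0" using M0 by simp
      have x9: "norm x \<le> 9 / 10"
      proof (rule ccontr)
        assume n: "\<not> norm x \<le> 9 / 10"
        have "(9 / 10)\<^sup>2 \<le> (norm x)\<^sup>2" using n by (intro power_mono) auto
        then have w: "1 - (norm x)\<^sup>2 \<le> 19 / 100" by (simp add: power2_eq_square)
        have w0: "0 \<le> 1 - (norm x)\<^sup>2" using x by (simp add: power_le_one)
        have "M = \<bar>p x\<bar> * (1 - (norm x)\<^sup>2) ^ k" using w0 by (simp add: M_def P_def abs_mult)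
        also have "\<dots> \<le> (M * (25 / 16) ^ k * (10 / 3 * norm x) ^ k) * (19 / 100) ^ k"
          using w w0 outer[of x] n M0 by (intro mult_mono power_mono) auto
        also have "\<dots> \<le> (M * (25 / 16) ^ k * (10 / 3) ^ k) * (19 / 100) ^ k"
          using x M0 by (intro mult_right_mono mult_left_mono power_mono) auto
        \<comment> \<open>The constant is \<open>25 / 16 * (10 / 3) * (19 / 100)\<close>; that it is below \<open>1\<close> dictates the radii
          \<open>3 / 5\<close> and \<open>9 / 10\<close>.\<close>
        also have "\<dots> = M * (95 / 96) ^ k"
          unfolding mult.assoc power_mult_distrib[symmetric] by simp
        also have "\<dots> < M * 1"
          using k Mpos by (intro mult_strict_left_mono power_less_one_iff[THEN iffD2]) auto
        finally show False by simp
      qed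
      obtain y where y: "y \<in> Y" "norm (y - x) \<le> \<delta>" using net[OF x9] by auto
      have d0: "\<delta> \<ge> 0" using y(2) norm_ge_zero order_trans by blast
      have "10 * \<delta> \<le> real k * \<delta>" using k d0 by (intro mult_right_mono) auto
      then have d1: "\<delta> \<le> 1 / 125" using \<delta> by simp
      have Py: "\<bar>P z\<bar> \<le> \<bar>p z\<bar>" if "norm z \<le> 1" for z
      proof -
        have "\<bar>(1 - (norm z)\<^sup>2) ^ k\<bar> \<le> 1" using that
          by (simp add: power_abs abs_square_le_1 power_le_one)
        from mult_left_mono[OF this abs_ge_zero[of "p z"]] show ?thesis by (simp add: P_def abs_mult)
      qed
      have ny: "norm y \<le> 908 / 1000" using norm_triangle_sub[of y x] x9 y(2) d1 by linarith
      have "M \<le> 18 * \<bar>P y\<bar>"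
      proof (cases "y = x")
        case True then show ?thesis using M0 by (simp add: M_def)
      next
        case False
        define e where "e = (y - x) /\<^sub>R norm (y - x)"
        have e: "e \<bullet> e = 1" using False by (simp add: e_def dot_square_norm power2_eq_square)
        define t0 where "t0 = x \<bullet> e"
        define t1 where "t1 = t0 + norm (y - x)"
        define a where "a = x - t0 *\<^sub>R e"
        have ae: "a \<bullet> e = 0" by (simp add: a_def t0_def inner_diff_left e)
        have x_eq: "x = a + t0 *\<^sub>R e" by (simp add: a_def)
        have "norm (y - x) *\<^sub>R e = y - x" using False by (simp add: e_def)
        moreover have "a + t1 *\<^sub>R e = x + norm (y - x) *\<^sub>R e"
          unfolding a_def t1_def scaleR_left_distrib by simp
        ultimately have y_eq: "y = a + t1 *\<^sub>R e" by (metis add.commute diff_add_cancel)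
        have pyth: "(norm (a + t *\<^sub>R e))\<^sup>2 = (norm a)\<^sup>2 + t\<^sup>2" for t
          unfolding power2_norm_eq_inner
          using ae e inner_commute[of e a] by (simp add: inner_add_left inner_add_right power2_eq_square)
        obtain q where q: "degree q \<le> k" "\<And>t. p (a + t *\<^sub>R e) = poly q t"
          using p unfolding line_poly_def by blast
        define Q where "Q = q * [:1 - (norm a)\<^sup>2, 0, -1:] ^ k"
        have degQ: "degree Q \<le> 3 * k"
        proof -
          have "degree [:1 - (norm a)\<^sup>2, 0, -1:] \<le> 2" by (simp add: degree_pCons_eq_if)
          then have "degree ([:1 - (norm a)\<^sup>2, 0, -1:] ^ k) \<le> 2 * k"
            using degree_power_le[of "[:1 - (norm a)\<^sup>2, 0, -1:]" k] by (meson mult_le_mono1 order_trans)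
          then show ?thesis unfolding Q_def using degree_mult_le[of q "[:1 - (norm a)\<^sup>2, 0, -1:] ^ k"] q(1) by linarith
        qed
        have Q: "poly Q t = P (a + t *\<^sub>R e)" for t
          unfolding Q_def P_def pyth q(2) by (simp add: poly_power power2_eq_square algebra_simps)
        have "(norm x)\<^sup>2 \<le> (9 / 10)\<^sup>2" using x9 by (intro power_mono) auto
        then have xs: "(norm a)\<^sup>2 + t0\<^sup>2 \<le> 81 / 100" 
          unfolding pyth[of t0, folded x_eq] by (simp add: power_divide)
        have a1: "(norm a)\<^sup>2 < 1" using xs zero_le_power2[of t0] by linarith
        \<comment> \<open>The half-length of the chord; by the power of a point,
          \<open>A\<^sup>2 - t\<^sup>2 = 1 - \<bar>a + t e\<bar>\<^sup>2\<close>, so the angular scale on the chord is that of the ball.\<close>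
        define A where "A = sqrt (1 - (norm a)\<^sup>2)"
        have A: "A > 0" "A\<^sup>2 = 1 - (norm a)\<^sup>2" using a1 by (auto simp: A_def)
        have lt_A: "\<bar>t\<bar> < A" if "norm (a + t *\<^sub>R e) < 1" for t
        proof -
          have "(norm (a + t *\<^sub>R e))\<^sup>2 < 1" using that by (simp add: abs_square_less_1)
          then have "t\<^sup>2 < A\<^sup>2" using A pyth[of t] by simp
          then have "\<bar>t\<bar>\<^sup>2 < A\<^sup>2" by simp
          then show ?thesis using A(1) by (rule power2_less_imp_less[OF _ less_imp_le])
        qed
        have le_A: "norm (a + t *\<^sub>R e) \<le> 1" if "\<bar>t\<bar> \<le> A" for t
        proof -
          have "\<bar>t\<bar>\<^sup>2 \<le> A\<^sup>2" using that by (intro power_mono) auto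
          then have "(norm (a + t *\<^sub>R e))\<^sup>2 \<le> 1" using A pyth[of t] by simp
          then show ?thesis by (simp add: abs_square_le_1)
        qed
        have "M \<le> 18 * \<bar>poly Q t1\<bar>"
        proof (rule poly_near_max[OF degQ _ A(1)])
          show "\<bar>poly Q t\<bar> \<le> M" if "\<bar>t\<bar> \<le> A" for t
            unfolding Q M_def by (intro maxx le_A that)
          show "\<bar>t0\<bar> < A" by (rule lt_A) (use x9 x_eq in simp)
          show "\<bar>t1\<bar> < A" by (rule lt_A) (use ny y_eq in simp)
          show "\<bar>poly Q t0\<bar> = M" unfolding Q M_def using x_eq by simp
          show "0 < (2 / 5 :: real)" by simp
          show "real (3 * k) * \<bar>t1 - t0\<bar> \<le> 3 / 5 * (2 / 5)"
          proof -
            have "real k * \<bar>t1 - t0\<bar> \<le> real k * \<delta>" using y(2) by (intro mult_left_mono) (auto simp: t1_def)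
            then show ?thesis using \<delta> by simp
          qed
          show "(2 / 5)\<^sup>2 \<le> A\<^sup>2 - s\<^sup>2" if "s \<in> closed_segment t0 t1" for s
          proof -
            have "t0 \<le> s" "s \<le> t1" using that by (auto simp: closed_segment_eq_real_ivl t1_def split: if_splits)
            have "a + s *\<^sub>R e = x + (s - t0) *\<^sub>R e" by (simp add: a_def scaleR_left_diff_distrib)
            then have "norm (a + s *\<^sub>R e) \<le> norm x + \<bar>s - t0\<bar> * norm e" by (metis norm_scaleR norm_triangle_ineq)
            also have "norm e = 1" using e by (simp add: norm_eq_1)
            also have "norm x + \<bar>s - t0\<bar> * 1 \<le> 908 / 1000"
              using \<open>t0 \<le> s\<close> \<open>s \<le> t1\<close> y(2) d1 x9 by (simp add: t1_def)
            finally have "(norm (a + s *\<^sub>R e))\<^sup>2 \<le> (908 / 1000)\<^sup>2" by (intro power_mono) auto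
            then show ?thesis using A pyth[of s] by (simp add: power2_eq_square)
          qed
        qed
        then show ?thesis using y_eq by (simp add: Q)
      qed
      also have "\<dots> \<le> 18 * B" using Py[of y] ny B[OF y(1)] by simp
      finally show ?thesis .
    qed
  qed (use r in auto)
  finally show ?thesis .
qed

lemma prod_dist_fact:
  assumes "i \<le> k"
  shows "(\<Prod>j\<in>{..k} - {i}. \<bar>real i - real j\<bar>) = fact i * fact (k - i)"
proof -
  have "(\<Prod>j\<in>{..k} - {i}. \<bar>real i - real j\<bar>) = (\<Prod>j\<in>{0..<i} \<union> {i<..k}. \<bar>real i - real j\<bar>)"
    using assms by (intro prod.cong) auto
  also have "\<dots> = (\<Prod>j\<in>{0..<i}. \<bar>real i - real j\<bar>) * (\<Prod>j\<in>{i<..k}. \<bar>real i - real j\<bar>)"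
    by (rule prod.union_disjoint) auto
  also have "(\<Prod>j\<in>{0..<i}. \<bar>real i - real j\<bar>) = (\<Prod>j\<in>{0..<i}. real (i - j))"
    by (intro prod.cong) auto
  also have "\<dots> = fact i" by (simp add: fact_prod_rev)
  also have "(\<Prod>j\<in>{i<..k}. \<bar>real i - real j\<bar>) = (\<Prod>j\<in>{1..k - i}. real j)"
    by (rule prod.reindex_bij_witness[of _ "\<lambda>j. j + i" "\<lambda>j. j - i"]) auto
  also have "\<dots> = fact (k - i)" by (simp add: fact_prod)
  finally show ?thesis .
qed

text \<open>The Lagrange basis polynomials are bounded by comparison with equally spaced nodes, where the
  denominators are products of factorials and add up to a row of binomial coefficients.\<close>

lemma lagrange_bound:
  fixes Q :: "real poly" and y :: "nat \<Rightarrow> real"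
  assumes deg: "degree Q \<le> k" and y: "\<And>i. i \<le> k \<Longrightarrow> \<bar>y i\<bar> \<le> 1" and \<epsilon>: "\<epsilon> > 0"
    and sep: "\<And>i j. i \<le> k \<Longrightarrow> j \<le> k \<Longrightarrow> \<epsilon> * \<bar>real i - real j\<bar> \<le> \<bar>y i - y j\<bar>"
    and B: "\<And>i. i \<le> k \<Longrightarrow> \<bar>poly Q (y i)\<bar> \<le> B" and x: "\<bar>x\<bar> \<le> 1"
  shows "\<bar>poly Q x\<bar> \<le> B * (4 / \<epsilon>) ^ k / fact k"
proof -
  define l where "l = (\<lambda>i. \<Prod>j\<in>{..k} - {i}. [:- y j / (y i - y j), 1 / (y i - y j):])"
  have ne: "y i \<noteq> y j" if "i \<le> k" "j \<le> k" "i \<noteq> j" for i j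
  proof -
    have "\<epsilon> * \<bar>real i - real j\<bar> > 0" using \<epsilon> that by simp
    then show ?thesis using sep[of i j] that by auto
  qed
  have l: "poly (l i) t = (\<Prod>j\<in>{..k} - {i}. (t - y j) / (y i - y j))" for i t
    unfolding l_def poly_prod by (intro prod.cong) (auto simp: diff_divide_distrib)
  have degl: "degree (l i) \<le> k" if "i \<le> k" for i
  proof -
    have "degree (l i) \<le> (\<Sum>j\<in>{..k} - {i}. degree [:- y j / (y i - y j), 1 / (y i - y j):])"
      unfolding l_def by (rule degree_prod_sum_le[unfolded comp_def]) simp
    also have "\<dots> \<le> (\<Sum>j\<in>{..k} - {i}. 1)" by (intro sum_mono) (simp add: degree_pCons_eq_if)
    also have "\<dots> = k" using that by simp
    finally show ?thesis .
  qed
  define L where "L = (\<Sum>i\<le>k. smult (poly Q (y i)) (l i))"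
  have "Q = L"
  proof (rule poly_eqI_degree[of "y ` {..k}"])
    have "inj_on y {..k}" using ne by (auto simp: inj_on_def)
    then have c: "card (y ` {..k}) = Suc k" by (simp add: card_image)
    then show "degree Q < card (y ` {..k})" using deg by simp
    have "degree L \<le> k" unfolding L_def
      by (intro degree_sum_le) (auto intro: order_trans[OF degree_smult_le] degl)
    then show "degree L < card (y ` {..k})" using c by simp
    fix t assume "t \<in> y ` {..k}"
    then obtain m where m: "m \<le> k" "t = y m" by auto
    have "poly (l i) (y m) = (if i = m then 1 else 0)" if "i \<le> k" for i
    proof (cases "i = m")
      case True
      then have "poly (l i) (y m) = (\<Prod>j\<in>{..k} - {i}. 1)" unfolding l using ne m
        by (intro prod.cong) auto
      then show ?thesis using True by simp
    next
      case False
      then show ?thesis unfolding l using m by (auto intro!: prod_zero)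
    qed
    then have "poly L t = (\<Sum>i\<le>k. if i = m then poly Q (y i) else 0)"
      unfolding L_def poly_sum m by (intro sum.cong) auto
    then show "poly Q t = poly L t" using m by simp
  qed
  have B0: "B \<ge> 0" using B[of 0] by simp
  have bound: "\<bar>poly (l i) x\<bar> \<le> (2 / \<epsilon>) ^ k / (fact i * fact (k - i))" if i: "i \<le> k" for i
  proof -
    have "\<bar>poly (l i) x\<bar> = (\<Prod>j\<in>{..k} - {i}. \<bar>x - y j\<bar> / \<bar>y i - y j\<bar>)"
      unfolding l abs_prod by simp
    also have "\<dots> \<le> (\<Prod>j\<in>{..k} - {i}. (2 / \<epsilon>) / \<bar>real i - real j\<bar>)"
    proof (rule prod_mono)
      fix j assume j: "j \<in> {..k} - {i}"
      have "\<bar>x - y j\<bar> / \<bar>y i - y j\<bar> \<le> 2 / (\<epsilon> * \<bar>real i - real j\<bar>)"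
        using j i x y[of j] \<epsilon> sep[of i j] by (intro frac_le) (auto simp: abs_if split: if_splits)
      then show "0 \<le> \<bar>x - y j\<bar> / \<bar>y i - y j\<bar> \<and> \<bar>x - y j\<bar> / \<bar>y i - y j\<bar> \<le> 2 / \<epsilon> / \<bar>real i - real j\<bar>"
        by simp
    qed
    also have "\<dots> = (2 / \<epsilon>) ^ k / (fact i * fact (k - i))"
      using i unfolding prod_dividef prod_dist_fact[OF i] by (simp add: power_divide)
    finally show ?thesis .
  qed
  have "\<bar>poly Q x\<bar> = \<bar>\<Sum>i\<le>k. poly Q (y i) * poly (l i) x\<bar>"
    using arg_cong[OF \<open>Q = L\<close>, of "\<lambda>q. \<bar>poly q x\<bar>"] by (simp add: L_def poly_sum)
  also have "\<dots> \<le> (\<Sum>i\<le>k. \<bar>poly Q (y i)\<bar> * \<bar>poly (l i) x\<bar>)"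
    by (rule order_trans[OF sum_abs]) (simp add: abs_mult)
  also have "\<dots> \<le> (\<Sum>i\<le>k. B * ((2 / \<epsilon>) ^ k / (fact i * fact (k - i))))"
    using B bound B0 by (intro sum_mono mult_mono) auto
  also have "\<dots> = (\<Sum>i\<le>k. B * (2 / \<epsilon>) ^ k / fact k * of_nat (k choose i))"
    by (intro sum.cong refl) (simp add: binomial_fact)
  also have "\<dots> = B * (2 / \<epsilon>) ^ k / fact k * of_nat (\<Sum>i\<le>k. k choose i)"
    by (simp add: sum_distrib_left)
  also have "\<dots> = B * ((2 / \<epsilon>) ^ k * 2 ^ k) / fact k" by (simp add: choose_row_sum)
  also have "(2 / \<epsilon>) ^ k * 2 ^ k = (4 / \<epsilon>) ^ k" by (simp flip: power_mult_distrib)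
  finally show ?thesis .
qed

definition unit_cube :: "(real ^ 'n) set" where "unit_cube = {u. \<forall>i. \<bar>u $ i\<bar> \<le> 1}"

definition cube_net :: "(real ^ 'n) set \<Rightarrow> real \<Rightarrow> bool" where
  "cube_net Y \<delta> \<longleftrightarrow> Y \<subseteq> unit_cube \<and> (\<forall>u\<in>unit_cube. \<exists>y\<in>Y. \<forall>i. \<bar>y $ i - u $ i\<bar> \<le> \<delta>)"

lemma norm_le_sqrt_card:
  fixes x :: "real ^ 'n"
  assumes "\<And>i. \<bar>x $ i\<bar> \<le> c"
  shows "norm x \<le> sqrt (real CARD('n)) * c"
proof -
  have c: "c \<ge> 0" using assms[of undefined] by linarith
  have "norm x = sqrt (\<Sum>i\<in>UNIV. (x $ i)\<^sup>2)" by (simp add: norm_vec_def L2_set_def)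
  also have "\<dots> \<le> sqrt (\<Sum>i\<in>(UNIV :: 'n set). c\<^sup>2)"
    using assms by (intro real_sqrt_le_mono sum_mono) (metis abs_le_square_iff abs_of_nonneg c)
  also have "\<dots> = sqrt (real CARD('n)) * c" using c by (simp add: real_sqrt_mult)
  finally show ?thesis .
qed

text \<open>In one dimension the damping argument needs a finer net than \<open>\<gamma>\<^sub>1 = 2\<close> provides, but interpolation
  does better: points of the net closest to nodes of spacing \<open>6 / q\<close> keep a distance of at least
  \<open>2 / q\<close> per index step.\<close>

lemma norming_univariate:
  fixes p :: "real ^ 'n \<Rightarrow> real"
  assumes n: "CARD('n) = 1" and p: "line_poly k p" and q: "q > 0" "3 * real k \<le> q"
    and net: "cube_net Y (2 / q)" and B: "\<And>y. y \<in> Y \<Longrightarrow> \<bar>p y\<bar> \<le> B" and u: "u \<in> unit_cube"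
  shows "\<bar>p u\<bar> \<le> B * (2 * q) ^ k / fact k"
proof -
  obtain i0 :: 'n where "(UNIV :: 'n set) = {i0}" using n by (rule card_1_singletonE)
  then have i0: "x $ i = x $ i0" for x :: "real ^ 'n" and i
    by (metis UNIV_I singletonD)
  define v :: "real ^ 'n" where "v = 1"
  have xv: "x = 0 + (x $ i0) *\<^sub>R v" for x :: "real ^ 'n"
    unfolding vec_eq_iff v_def using i0[of x] by simp
  obtain Q where Q: "degree Q \<le> k" "\<And>t. p (0 + t *\<^sub>R v) = poly Q t"
    using p unfolding line_poly_def by blast
  have pQ: "p x = poly Q (x $ i0)" for x by (subst xv) (rule Q(2))
  have "\<exists>y\<in>Y. \<bar>y $ i0 - (-1 + 6 * real i / q)\<bar> \<le> 2 / q" if i: "i \<le> k" for i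
  proof -
    have "6 * real i \<le> 2 * q" using i q by linarith
    then have "6 * real i / q \<le> 2" using q by (simp add: field_simps)
    moreover have "0 \<le> 6 * real i / q" using q by simp
    ultimately have "(-1 + 6 * real i / q) *\<^sub>R v \<in> unit_cube" by (auto simp: unit_cube_def v_def)
    then obtain y where "y \<in> Y" "\<forall>i'. \<bar>y $ i' - ((-1 + 6 * real i / q) *\<^sub>R v) $ i'\<bar> \<le> 2 / q"
      using net unfolding cube_net_def by blast
    then show ?thesis by (auto simp: v_def)
  qed
  then have "\<forall>i\<in>{..k}. \<exists>y. y \<in> Y \<and> \<bar>y $ i0 - (-1 + 6 * real i / q)\<bar> \<le> 2 / q" by blast
  from bchoice[OF this] obtain Y' where
    Y': "\<And>i. i \<le> k \<Longrightarrow> Y' i \<in> Y \<and> \<bar>Y' i $ i0 - (-1 + 6 * real i / q)\<bar> \<le> 2 / q"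
    by auto
  have "\<bar>poly Q (u $ i0)\<bar> \<le> B * (4 / (2 / q)) ^ k / fact k"
  proof (rule lagrange_bound[OF Q(1), of "\<lambda>i. Y' i $ i0"])
    show "\<bar>Y' i $ i0\<bar> \<le> 1" if "i \<le> k" for i
      using Y'[OF that] net by (auto simp: cube_net_def unit_cube_def)
    show "\<bar>poly Q (Y' i $ i0)\<bar> \<le> B" if "i \<le> k" for i
      unfolding pQ[symmetric] using Y'[OF that] B by blast
    show "2 / q * \<bar>real i - real j\<bar> \<le> \<bar>Y' i $ i0 - Y' j $ i0\<bar>" if "i \<le> k" "j \<le> k" for i j
    proof (cases "i = j")
      case False
      then have "1 \<le> \<bar>real i - real j\<bar>" by auto
      then have "2 / q * \<bar>real i - real j\<bar> + 4 / q \<le> 6 / q * \<bar>real i - real j\<bar>"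
        using q by (simp add: field_simps)
      also have "6 / q * \<bar>real i - real j\<bar> = \<bar>6 / q * (real i - real j)\<bar>" unfolding abs_mult using q by simp
      also have "6 / q * (real i - real j) = (-1 + 6 * real i / q) - (-1 + 6 * real j / q)"
        by (simp add: diff_divide_distrib right_diff_distrib)
      finally show ?thesis using Y'[OF that(1)] Y'[OF that(2)] by linarith
    qed simp
    show "\<bar>u $ i0\<bar> \<le> 1" using u by (simp add: unit_cube_def)
  qed (use q in auto)
  then show ?thesis using pQ by simp
qed

lemma gamma_seq_ge: "n \<ge> 2 \<Longrightarrow> gamma_seq n \<ge> 6 * real n"
proof -
  have "gamma_seq m \<ge> 2" if "m \<ge> 1" for m using that
  proof (induction m rule: nat_induct_at_least)
    case (Suc m)
    have "2 * real (Suc m) * (1 + gamma_seq m) \<ge> 2 * 1 * (1 + 0)"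
      using Suc by (intro mult_mono) auto
    then show ?case by simp
  qed simp
  moreover assume "n \<ge> 2"
  ultimately have "gamma_seq (n - 1) \<ge> 2" by simp
  then have "2 * real n * (1 + gamma_seq (n - 1)) \<ge> 2 * real n * 3" by (intro mult_left_mono) auto
  then show ?thesis using gamma_seq_rec[of n] \<open>n \<ge> 2\<close> by simp
qed

text \<open>A net of mesh \<open>2 / q\<close> with \<open>q\<close> at least \<open>3 * \<gamma> * k\<close> determines polynomials of degree \<open>k\<close> up to a
  factor exponential in \<open>k\<close>. The factor \<open>3\<close> is what counts: any constant below \<open>4\<close> yields an exponent
  larger than the \<open>c'\<close> of the theorem. In dimension at least two the inequality \<open>\<gamma> \<ge> 6 * n\<close> makes the
  mesh fine enough for the Euclidean diameter of the cells. In dimension one the upper bound on \<open>q\<close> turns the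
  factor \<open>(2 * q) ^ k / fact k\<close> of Lagrange interpolation into an exponential in \<open>k\<close>.\<close>

theorem norming_constant:
  defines "\<gamma> \<equiv> gamma_seq CARD('n::finite)"
  obtains A :: real where "A \<ge> 1"
    "\<And>k q Y B (p :: real ^ 'n \<Rightarrow> real) u. k \<ge> 10 \<Longrightarrow> 3 * \<gamma> * real k \<le> q \<Longrightarrow> q \<le> 6 * \<gamma> * real k \<Longrightarrow>
      cube_net Y (2 / q) \<Longrightarrow> line_poly k p \<Longrightarrow> continuous_on UNIV p \<Longrightarrow>
      (\<And>y. y \<in> Y \<Longrightarrow> \<bar>p y\<bar> \<le> B) \<Longrightarrow> u \<in> unit_cube \<Longrightarrow> \<bar>p u\<bar> \<le> A ^ k * B"
proof (cases "CARD('n) = 1")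
  case True
  then have \<gamma>: "\<gamma> = 2" by (simp add: \<gamma>_def)
  show ?thesis
  proof (rule that[of "24 * exp 1"])
    have "exp 1 \<ge> (1::real)" by simp
    then show "24 * exp 1 \<ge> (1::real)" by linarith
    fix k q and Y :: "(real ^ 'n) set" and B and p :: "real ^ 'n \<Rightarrow> real" and u :: "real ^ 'n"
    assume k: "k \<ge> 10" and q: "3 * \<gamma> * real k \<le> q" "q \<le> 6 * \<gamma> * real k" and net: "cube_net Y (2 / q)"
      and p: "line_poly k p" and B: "\<And>y. y \<in> Y \<Longrightarrow> \<bar>p y\<bar> \<le> B" and u: "u \<in> unit_cube"
    obtain y where "y \<in> Y" using net u unfolding cube_net_def by blast
    then have B0: "B \<ge> 0" using B by fastforce
    have "\<bar>p u\<bar> \<le> B * (2 * q) ^ k / fact k"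
      by (rule norming_univariate[OF True p _ _ net B u]) (use q k \<gamma> in auto)
    also have "\<dots> \<le> B * (24 * real k) ^ k / fact k"
      using q k B0 by (intro divide_right_mono mult_left_mono power_mono) (auto simp: \<gamma>)
    also have "\<dots> = B * 24 ^ k * (real k ^ k / fact k)" by (simp add: power_mult_distrib)
    also have "\<dots> \<le> B * 24 ^ k * exp (real k)"
      using power_le_fact_exp[of "real k" k] B0
      by (intro mult_left_mono) (auto simp: pos_divide_le_eq mult.commute)
    also have "exp (real k) = exp 1 ^ k" by (simp flip: exp_of_nat_mult)
    finally show "\<bar>p u\<bar> \<le> (24 * exp 1) ^ k * B" by (simp add: power_mult_distrib mult_ac)
  qed
next
  case False
  define s where "s = sqrt (real CARD('n))"
  have n2: "CARD('n) \<ge> 2" using False zero_less_card_finite[where 'a='n] by linarith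
  have s1: "s \<ge> 25 / 18" unfolding s_def using n2 by (intro real_le_rsqrt) (auto simp: power2_eq_square)
  have ss: "s * s = real CARD('n)" by (simp add: s_def)
  have \<gamma>: "\<gamma> \<ge> 6 * (s * s)" using gamma_seq_ge[OF n2] by (simp add: \<gamma>_def ss)
  show ?thesis
  proof (rule that[of "18 * (125 / 24 * s)"])
    show "18 * (125 / 24 * s) \<ge> 1" using s1 by simp
    fix k q and Y :: "(real ^ 'n) set" and B and p :: "real ^ 'n \<Rightarrow> real" and u :: "real ^ 'n"
    assume k: "k \<ge> 10" and q: "3 * \<gamma> * real k \<le> q" and net: "cube_net Y (2 / q)"
      and p: "line_poly k p" "continuous_on UNIV p"
      and B: "\<And>y. y \<in> Y \<Longrightarrow> \<bar>p y\<bar> \<le> B" and u: "u \<in> unit_cube"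
    obtain y where "y \<in> Y" using net u unfolding cube_net_def by blast
    then have B0: "B \<ge> 0" using B by fastforce
    have kpos: "real k > 0" using k by simp
    have "18 * (s * s) * real k \<le> 3 * \<gamma> * real k" using \<gamma> by (intro mult_right_mono) auto
    then have q': "18 * (s * s) * real k \<le> q" using q by linarith
    have "25 / 18 * s \<le> s * s" using s1 by (intro mult_right_mono) auto
    then have "25 * s * real k \<le> 18 * (s * s) * real k" by (intro mult_right_mono) auto
    then have q'': "25 * s * real k \<le> q" using q' by linarith
    have "0 < 25 * s * real k" using s1 kpos by simp
    then have qpos: "q > 0" using q'' by linarith
    have "\<bar>p u\<bar> \<le> 18 * B * (125 / 24 * s) ^ k"
    proof (rule norming_ball[OF p k, of Y "s * (2 / q)"])
      show "\<exists>y\<in>Y. norm (y - x) \<le> s * (2 / q)" if "norm x \<le> 9 / 10" for x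
      proof -
        have "\<bar>x $ i\<bar> \<le> 1" for i using component_le_norm_cart[of x i] that by linarith
        then have "x \<in> unit_cube" by (simp add: unit_cube_def)
        then obtain y where "y \<in> Y" "\<forall>i. \<bar>y $ i - x $ i\<bar> \<le> 2 / q" using net unfolding cube_net_def by blast
        then show ?thesis using norm_le_sqrt_card[of "y - x" "2 / q"] by (auto simp: s_def)
      qed
      show "real k * (s * (2 / q)) \<le> 2 / 25" using q'' qpos by (simp add: field_simps)
      show "norm u \<le> s" using norm_le_sqrt_card[of u 1] u by (simp add: s_def unit_cube_def)
    qed (use B s1 in auto)
    also have "\<dots> \<le> 18 ^ k * B * (125 / 24 * s) ^ k"
      using B0 s1 k by (intro mult_right_mono self_le_power) auto
    finally show "\<bar>p u\<bar> \<le> (18 * (125 / 24 * s)) ^ k * B" by (simp only: power_mult_distrib mult_ac)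
  qed
qed

section \<open>Quadrature formulas and the Gaussian form\<close>

text \<open>Riesz representation on a finite set: point evaluation at \<open>x\<close> is a bounded functional on the
  restrictions to \<open>Y\<close>, with the Euclidean inner product over \<open>Y\<close>. The representer is
  \<open>c = (\<Sum>e\<in>E. e x * e)\<close> for an orthonormal family \<open>E\<close> produced by the Gram--Schmidt process, and its norm
  is at most that of the functional because \<open>\<bar>c\<bar>\<^sup>2 = c x\<close>.\<close>

lemma norming_imp_quadrature:
  fixes V :: "('a \<Rightarrow> real) set"
  assumes Y: "finite Y" and B: "finite B" "B \<subseteq> V"
    and zero: "(\<lambda>z. 0) \<in> V" and add: "\<And>p r. p \<in> V \<Longrightarrow> r \<in> V \<Longrightarrow> (\<lambda>z. p z + r z) \<in> V"
    and scale: "\<And>p c. p \<in> V \<Longrightarrow> (\<lambda>z. c * p z) \<in> V"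
    and A: "A \<ge> 0" and norming: "\<And>p. p \<in> V \<Longrightarrow> (p x)\<^sup>2 \<le> A\<^sup>2 * (\<Sum>y\<in>Y. (p y)\<^sup>2)"
  shows "\<exists>c. (\<forall>b\<in>B. (\<Sum>y\<in>Y. c y * b y) = b x) \<and> (\<Sum>y\<in>Y. (c y)\<^sup>2) \<le> A\<^sup>2"
proof -
  have sum_in: "(\<lambda>z. \<Sum>e\<in>E. u e * e z) \<in> V" if "finite E" "E \<subseteq> V" for E and u :: "('a \<Rightarrow> real) \<Rightarrow> real"
    using that by (induction E) (auto intro!: zero add scale)
  have "\<exists>E. finite E \<and> E \<subseteq> V \<and> (\<forall>e\<in>E. \<forall>e'\<in>E. (\<Sum>y\<in>Y. e y * e' y) = (if e = e' then 1 else 0)) \<and>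
      (\<forall>b\<in>B. \<exists>u. \<forall>y\<in>Y. b y = (\<Sum>e\<in>E. u e * e y))"
    using B
  proof (induction B)
    case empty
    then show ?case by (intro exI[of _ "{}"]) auto
  next
    case (insert b B)
    have "B \<subseteq> V" using insert.prems by simp
    from insert.IH[OF this] obtain E where E: "finite E" "E \<subseteq> V"
      and on: "\<forall>e\<in>E. \<forall>e'\<in>E. (\<Sum>y\<in>Y. e y * e' y) = (if e = e' then 1 else 0)"
      and gen: "\<forall>b\<in>B. \<exists>u. \<forall>y\<in>Y. b y = (\<Sum>e\<in>E. u e * e y)" by (elim exE conjE)
    note on = on[rule_format] and gen = bspec[OF gen]
    define w where "w = (\<lambda>e. \<Sum>y\<in>Y. b y * e y)"
    define r where "r = (\<lambda>z. b z + (\<Sum>e\<in>E. (- w e) * e z))"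
    have rV: "r \<in> V" unfolding r_def using insert.prems by (intro add sum_in E) auto
    have orth: "(\<Sum>y\<in>Y. r y * e y) = 0" if e: "e \<in> E" for e
    proof -
      have "(\<Sum>y\<in>Y. r y * e y) = (\<Sum>y\<in>Y. b y * e y - (\<Sum>e'\<in>E. w e' * (e' y * e y)))"
        by (intro sum.cong refl) (simp add: r_def left_diff_distrib sum_distrib_right mult.assoc sum_negf)
      also have "\<dots> = w e - (\<Sum>y\<in>Y. \<Sum>e'\<in>E. w e' * (e' y * e y))"
        unfolding sum_subtractf w_def ..
      also have "(\<Sum>y\<in>Y. \<Sum>e'\<in>E. w e' * (e' y * e y)) = (\<Sum>e'\<in>E. w e' * (\<Sum>y\<in>Y. e' y * e y))"
        by (subst sum.swap) (simp add: sum_distrib_left)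
      also have "\<dots> = (\<Sum>e'\<in>E. if e' = e then w e else 0)"
        using e by (intro sum.cong) (auto simp: on)
      also have "\<dots> = w e" using e E by simp
      finally show ?thesis by simp
    qed
    have b_eq: "b z = r z + (\<Sum>e\<in>E. w e * e z)" for z by (simp add: r_def sum_negf)
    \<comment> \<open>\<open>r\<close> is the part of \<open>b\<close> orthogonal to \<open>E\<close>; it enlarges \<open>E\<close> unless it vanishes on \<open>Y\<close>.\<close>
    show ?case
    proof (cases "(\<Sum>y\<in>Y. (r y)\<^sup>2) = 0")
      case True
      then have "\<forall>y\<in>Y. r y = 0" using Y by (subst (asm) sum_nonneg_eq_0_iff) auto
      then have "\<exists>u. \<forall>y\<in>Y. b y = (\<Sum>e\<in>E. u e * e y)" using b_eq by (intro exI[of _ w]) auto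
      then show ?thesis using E on gen by (intro exI[of _ E]) auto
    next
      case False
      define s where "s = sqrt (\<Sum>y\<in>Y. (r y)\<^sup>2)"
      have "(\<Sum>y\<in>Y. (r y)\<^sup>2) > 0" using False sum_nonneg[of Y "\<lambda>y. (r y)\<^sup>2"] by simp
      then have s: "s > 0" "s * s = (\<Sum>y\<in>Y. (r y)\<^sup>2)" by (auto simp: s_def)
      define e0 where "e0 = (\<lambda>z. (1 / s) * r z)"
      have e0V: "e0 \<in> V" unfolding e0_def by (intro scale rV)
      have orth0: "(\<Sum>y\<in>Y. e0 y * e y) = 0" if "e \<in> E" for e
        using orth[OF that] unfolding e0_def mult.assoc sum_distrib_left[symmetric] by simp
      have n0: "(\<Sum>y\<in>Y. e0 y * e0 y) = 1"
      proof -
        have "(\<Sum>y\<in>Y. e0 y * e0 y) = (\<Sum>y\<in>Y. (r y)\<^sup>2) / (s * s)"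
          unfolding e0_def sum_divide_distrib by (intro sum.cong) (auto simp: power2_eq_square)
        then show ?thesis using s by (metis divide_self_if False)
      qed
      have notin: "e0 \<notin> E" using orth0 n0 by auto
      have gen0: "\<exists>u. \<forall>y\<in>Y. b' y = (\<Sum>e\<in>insert e0 E. u e * e y)" if "b' \<in> insert b B" for b'
      proof -
        obtain t u where tu: "\<And>y. y \<in> Y \<Longrightarrow> b' y = t * e0 y + (\<Sum>e\<in>E. u e * e y)"
        proof (cases "b' = b")
          case True
          then show ?thesis using that[of s w] b_eq s by (simp add: e0_def)
        next
          case False
          then obtain u where "\<forall>y\<in>Y. b' y = (\<Sum>e\<in>E. u e * e y)" using gen[of b'] \<open>b' \<in> insert b B\<close> by auto
          then show ?thesis using that[of 0 u] by simp
        qed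
        have "(\<Sum>e\<in>E. (u(e0 := t)) e * e y) = (\<Sum>e\<in>E. u e * e y)" for y
          using notin by (intro sum.cong) auto
        then show ?thesis using tu E notin by (intro exI[of _ "u(e0 := t)"]) simp
      qed
      have on': "(\<Sum>y\<in>Y. e y * e' y) = (if e = e' then 1 else 0)" if "e \<in> insert e0 E" "e' \<in> insert e0 E" for e e'
      proof -
        note mem = that
        have comm: "(\<Sum>y\<in>Y. e y * e0 y) = (\<Sum>y\<in>Y. e0 y * e y)" by (simp only: mult.commute)
        consider "e = e0" "e' = e0" | "e = e0" "e' \<in> E" | "e \<in> E" "e' = e0" | "e \<in> E" "e' \<in> E"
          using mem by auto
        then show ?thesis
        proof cases
          case 1 then show ?thesis using n0 by simp
        next
          case 2 then show ?thesis using orth0[of e'] notin by auto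
        next
          case 3 then show ?thesis using orth0[of e] notin comm by auto
        next
          case 4 then show ?thesis by (rule on)
        qed
      qed
      show ?thesis
        by (intro exI[of _ "insert e0 E"] conjI ballI on' gen0) (use E e0V in auto)
    qed
  qed
  then obtain E where E: "finite E" "E \<subseteq> V"
      and on: "\<forall>e\<in>E. \<forall>e'\<in>E. (\<Sum>y\<in>Y. e y * e' y) = (if e = e' then 1 else 0)"
      and gen: "\<forall>b\<in>B. \<exists>u. \<forall>y\<in>Y. b y = (\<Sum>e\<in>E. u e * e y)" by (elim exE conjE)
    note on = on[rule_format] and gen = bspec[OF gen]
  define c where "c = (\<lambda>y. \<Sum>e\<in>E. e x * e y)"
  have ce: "(\<Sum>y\<in>Y. c y * e y) = e x" if e: "e \<in> E" for e
  proof -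
    have "(\<Sum>y\<in>Y. c y * e y) = (\<Sum>y\<in>Y. \<Sum>e'\<in>E. e' x * (e' y * e y))"
      unfolding c_def by (simp add: sum_distrib_right mult.assoc)
    also have "\<dots> = (\<Sum>e'\<in>E. e' x * (\<Sum>y\<in>Y. e' y * e y))"
      by (subst sum.swap) (simp add: sum_distrib_left)
    also have "\<dots> = (\<Sum>e'\<in>E. if e' = e then e x else 0)"
      using e by (intro sum.cong) (auto simp: on)
    finally show ?thesis using e E by simp
  qed
  have comb: "(\<Sum>y\<in>Y. c y * (\<Sum>e\<in>E. u e * e y)) = (\<Sum>e\<in>E. u e * e x)" for u
  proof -
    have "(\<Sum>y\<in>Y. c y * (\<Sum>e\<in>E. u e * e y)) = (\<Sum>y\<in>Y. \<Sum>e\<in>E. u e * (c y * e y))"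
      by (simp add: sum_distrib_left mult.left_commute)
    also have "\<dots> = (\<Sum>e\<in>E. u e * (\<Sum>y\<in>Y. c y * e y))"
      by (subst sum.swap) (simp add: sum_distrib_left)
    finally show ?thesis by (simp add: ce)
  qed
  have "(\<Sum>y\<in>Y. c y * b y) = b x" if b: "b \<in> B" for b
  proof -
    obtain u where u: "\<And>y. y \<in> Y \<Longrightarrow> b y = (\<Sum>e\<in>E. u e * e y)" using gen[OF b] by auto
    define r where "r = (\<lambda>z. b z + (\<Sum>e\<in>E. (- u e) * e z))"
    have rV: "r \<in> V" unfolding r_def using b B by (intro add sum_in E) auto
    have "(r x)\<^sup>2 \<le> A\<^sup>2 * (\<Sum>y\<in>Y. (r y)\<^sup>2)" by (rule norming[OF rV])
    also have "(\<Sum>y\<in>Y. (r y)\<^sup>2) = 0" using u by (intro sum.neutral) (simp add: r_def sum_negf)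
    finally have "b x = (\<Sum>e\<in>E. u e * e x)" by (simp add: r_def sum_negf)
    moreover have "(\<Sum>y\<in>Y. c y * b y) = (\<Sum>y\<in>Y. c y * (\<Sum>e\<in>E. u e * e y))"
      by (intro sum.cong refl) (simp only: u)
    ultimately show ?thesis by (simp only: comb)
  qed
  moreover have "(\<Sum>y\<in>Y. (c y)\<^sup>2) \<le> A\<^sup>2"
  proof -
    define S where "S = (\<Sum>e\<in>E. (e x)\<^sup>2)"
    have cS: "(\<Sum>y\<in>Y. (c y)\<^sup>2) = S"
      using comb[of "\<lambda>e. e x"] by (simp add: S_def c_def power2_eq_square)
    have cV: "c \<in> V" unfolding c_def by (intro sum_in E)
    have "c x = S" by (simp add: c_def S_def power2_eq_square)
    then have "S * S \<le> A\<^sup>2 * S" using norming[OF cV] cS by (simp add: power2_eq_square)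
    moreover have "S \<ge> 0" unfolding S_def by (intro sum_nonneg) auto
    ultimately have "S \<le> A\<^sup>2" by (cases "S = 0") (auto simp: mult_le_cancel_right)
    then show ?thesis by (simp add: cS)
  qed
  ultimately show ?thesis by blast
qed

lemma exp_minus_taylor_le:
  fixes z :: real
  assumes "\<bar>z\<bar> \<le> \<rho>" "k > 0"
  shows "\<bar>exp z - (\<Sum>m<k. z ^ m / fact m)\<bar> \<le> \<rho> ^ k / fact k * exp \<rho>"
proof -
  obtain t where t: "\<bar>t\<bar> \<le> \<bar>z\<bar>" "exp z = (\<Sum>m<k. z ^ m / fact m) + exp t / fact k * z ^ k"
    using Maclaurin_exp_le[of z k] by auto
  have "\<bar>exp z - (\<Sum>m<k. z ^ m / fact m)\<bar> = exp t / fact k * \<bar>z\<bar> ^ k"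
    by (simp add: t(2) abs_mult power_abs)
  also have "\<dots> \<le> exp \<rho> / fact k * \<rho> ^ k"
    using t assms by (intro mult_mono divide_right_mono power_mono) auto
  finally show ?thesis by (simp add: mult.commute)
qed

text \<open>After multiplication of the coefficients by \<open>exp (b * \<bar>u\<bar>\<^sup>2)\<close> the Gaussian becomes \<open>exp (2 * b * (u \<bullet> v))\<close>.
  Its Taylor terms of order below \<open>k\<close> are polynomials in \<open>u\<close> and are annihilated, so only the Taylor
  remainder is left; its \<open>1 / fact k\<close> is the source of the fast convergence.\<close>

lemma gaussian_form_annihilator:
  fixes F :: "'a::real_inner set" and \<mu> :: "'a \<Rightarrow> real"
  assumes F: "finite F" and b: "b \<ge> 0" and k: "k > 0" and \<rho>: "\<And>u. u \<in> F \<Longrightarrow> norm u \<le> \<rho>"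
    and ann: "\<And>m a. m < k \<Longrightarrow> a \<in> F \<Longrightarrow> (\<Sum>u\<in>F. \<mu> u * (u \<bullet> a) ^ m) = 0"
  shows "(\<Sum>u\<in>F. \<Sum>v\<in>F. (\<mu> u * exp (b * (norm u)\<^sup>2)) * (\<mu> v * exp (b * (norm v)\<^sup>2)) * exp (- b * (norm (u - v))\<^sup>2))
      \<le> (2 * b * \<rho>\<^sup>2) ^ k / fact k * exp (2 * b * \<rho>\<^sup>2) * (\<Sum>u\<in>F. \<bar>\<mu> u\<bar>)\<^sup>2" (is "?L \<le> ?T * _")
proof -
  define R where "R = (\<lambda>z::real. exp z - (\<Sum>m<k. z ^ m / fact m))"
  have "?L = (\<Sum>u\<in>F. \<Sum>v\<in>F. \<mu> u * \<mu> v * exp (2 * b * (u \<bullet> v)))"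
  proof (intro sum.cong refl)
    fix u v :: 'a
    have "b * (norm u)\<^sup>2 + b * (norm v)\<^sup>2 + (- b * (norm (u - v))\<^sup>2) = 2 * b * (u \<bullet> v)"
      by (simp add: power2_norm_eq_inner inner_diff_left inner_diff_right inner_commute[of v u] algebra_simps)
    then have "exp (b * (norm u)\<^sup>2) * exp (b * (norm v)\<^sup>2) * exp (- b * (norm (u - v))\<^sup>2) = exp (2 * b * (u \<bullet> v))"
      by (simp only: exp_add[symmetric])
    moreover have "(x * p) * (y * q) * r = x * y * (p * q * r)" for x y p q r :: real by (simp add: mult_ac)
    ultimately show "(\<mu> u * exp (b * (norm u)\<^sup>2)) * (\<mu> v * exp (b * (norm v)\<^sup>2)) * exp (- b * (norm (u - v))\<^sup>2)
        = \<mu> u * \<mu> v * exp (2 * b * (u \<bullet> v))" by (simp only:)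
  qed
  also have "\<dots> = (\<Sum>u\<in>F. \<Sum>v\<in>F. \<mu> u * \<mu> v * R (2 * b * (u \<bullet> v)))
      + (\<Sum>u\<in>F. \<Sum>v\<in>F. \<mu> u * \<mu> v * (\<Sum>m<k. (2 * b * (u \<bullet> v)) ^ m / fact m))"
    unfolding sum.distrib[symmetric] R_def by (intro sum.cong refl) (simp add: algebra_simps)
  also have "(\<Sum>u\<in>F. \<Sum>v\<in>F. \<mu> u * \<mu> v * (\<Sum>m<k. (2 * b * (u \<bullet> v)) ^ m / fact m)) = 0"
  proof -
    have "(\<Sum>u\<in>F. \<mu> u * \<mu> v * (\<Sum>m<k. (2 * b * (u \<bullet> v)) ^ m / fact m)) = 0" if v: "v \<in> F" for v
    proof -
      have "(\<Sum>u\<in>F. \<mu> u * \<mu> v * (\<Sum>m<k. (2 * b * (u \<bullet> v)) ^ m / fact m))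
          = (\<Sum>u\<in>F. \<Sum>m<k. (\<mu> v * (2 * b) ^ m / fact m) * (\<mu> u * (u \<bullet> v) ^ m))"
        unfolding sum_distrib_left by (intro sum.cong refl) (simp add: power_mult_distrib)
      also have "\<dots> = (\<Sum>m<k. (\<mu> v * (2 * b) ^ m / fact m) * (\<Sum>u\<in>F. \<mu> u * (u \<bullet> v) ^ m))"
        by (subst sum.swap) (simp add: sum_distrib_left)
      also have "\<dots> = 0" using ann[OF _ v] by (intro sum.neutral) auto
      finally show ?thesis .
    qed
    then show ?thesis by (subst sum.swap) simp
  qed
  also have "(\<Sum>u\<in>F. \<Sum>v\<in>F. \<mu> u * \<mu> v * R (2 * b * (u \<bullet> v))) + 0
      \<le> (\<Sum>u\<in>F. \<Sum>v\<in>F. \<bar>\<mu> u\<bar> * \<bar>\<mu> v\<bar> * ?T)"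
    unfolding add_0_right
  proof (intro sum_mono)
    fix u v assume uv: "u \<in> F" "v \<in> F"
    have "\<bar>u \<bullet> v\<bar> \<le> norm u * norm v" by (rule Cauchy_Schwarz_ineq2)
    also have "\<dots> \<le> \<rho> * \<rho>"
      using \<rho>[OF uv(1)] \<rho>[OF uv(2)] order_trans[OF norm_ge_zero \<rho>[OF uv(1)]] by (intro mult_mono) auto
    finally have "2 * b * \<bar>u \<bullet> v\<bar> \<le> 2 * b * \<rho>\<^sup>2" using b by (simp add: mult_left_mono power2_eq_square)
    then have "\<bar>2 * b * (u \<bullet> v)\<bar> \<le> 2 * b * \<rho>\<^sup>2" using b by (simp add: abs_mult)
    then have "\<bar>R (2 * b * (u \<bullet> v))\<bar> \<le> ?T" unfolding R_def using k by (rule exp_minus_taylor_le)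
    then have "\<bar>\<mu> u\<bar> * \<bar>\<mu> v\<bar> * \<bar>R (2 * b * (u \<bullet> v))\<bar> \<le> \<bar>\<mu> u\<bar> * \<bar>\<mu> v\<bar> * ?T" by (intro mult_left_mono) auto
    then have "\<bar>\<mu> u * \<mu> v * R (2 * b * (u \<bullet> v))\<bar> \<le> \<bar>\<mu> u\<bar> * \<bar>\<mu> v\<bar> * ?T" unfolding abs_mult .
    then show "\<mu> u * \<mu> v * R (2 * b * (u \<bullet> v)) \<le> \<bar>\<mu> u\<bar> * \<bar>\<mu> v\<bar> * ?T"
      by (rule order_trans[OF abs_ge_self])
  qed
  also have "\<dots> = ?T * (\<Sum>u\<in>F. \<bar>\<mu> u\<bar>)\<^sup>2"
    unfolding power2_eq_square sum_product sum_distrib_right[symmetric] by (rule mult.commute)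
  finally show ?thesis .
qed

lemma line_poly_zero: "line_poly k (\<lambda>z. 0)"
  unfolding line_poly_def by (intro allI exI[of _ 0]) auto

lemma line_poly_add:
  assumes "line_poly k p" "line_poly k r"
  shows "line_poly k (\<lambda>z. p z + r z)"
  unfolding line_poly_def
proof (intro allI)
  fix a e
  obtain P R where "degree P \<le> k" "\<forall>t. p (a + t *\<^sub>R e) = poly P t"
    "degree R \<le> k" "\<forall>t. r (a + t *\<^sub>R e) = poly R t" using assms unfolding line_poly_def by meson
  then show "\<exists>Q. degree Q \<le> k \<and> (\<forall>t. p (a + t *\<^sub>R e) + r (a + t *\<^sub>R e) = poly Q t)"
    by (intro exI[of _ "P + R"]) (auto intro: degree_add_le)
qed

lemma line_poly_scale:
  assumes "line_poly k p"
  shows "line_poly k (\<lambda>z. c * p z)"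
  unfolding line_poly_def
proof (intro allI)
  fix a e
  obtain P where "degree P \<le> k" "\<forall>t. p (a + t *\<^sub>R e) = poly P t"
    using assms unfolding line_poly_def by meson
  then show "\<exists>Q. degree Q \<le> k \<and> (\<forall>t. c * p (a + t *\<^sub>R e) = poly Q t)"
    by (intro exI[of _ "smult c P"]) (auto intro: order_trans[OF degree_smult_le])
qed

lemma line_poly_inner_power:
  assumes "m \<le> k"
  shows "line_poly k (\<lambda>z. (z \<bullet> b) ^ m)"
  unfolding line_poly_def
proof (intro allI)
  fix a e :: 'a
  have "degree ([:a \<bullet> b, e \<bullet> b:] ^ m) \<le> degree [:a \<bullet> b, e \<bullet> b:] * m" by (rule degree_power_le)
  also have "\<dots> \<le> 1 * m" by (intro mult_le_mono1) (simp add: degree_pCons_eq_if)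
  finally have "degree ([:a \<bullet> b, e \<bullet> b:] ^ m) \<le> k" using assms by simp
  then show "\<exists>Q. degree Q \<le> k \<and> (\<forall>t. ((a + t *\<^sub>R e) \<bullet> b) ^ m = poly Q t)"
    by (intro exI[of _ "[:a \<bullet> b, e \<bullet> b:] ^ m"]) (auto simp: inner_add_left poly_power)
qed

text \<open>A function with zeros on \<open>Y\<close> takes the same value under evaluation at \<open>u\<close> and under that evaluation
  minus the quadrature formula on \<open>Y\<close>. The latter annihilates the polynomials of degree below \<open>k\<close>, hence
  has a small Gaussian form.\<close>

lemma gaussian_zero_set_bound:
  fixes G :: "real ^ 'n \<Rightarrow> complex"
  assumes b: "b \<ge> 0" and N: "N \<ge> 0" and k: "k > 0" and A: "A \<ge> 0"
    and ev: "\<And>F l. finite F \<Longrightarrow> cmod (\<Sum>u\<in>F. of_real (l u) * G u)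
        \<le> N * sqrt (\<Sum>u\<in>F. \<Sum>v\<in>F. l u * l v * exp (- b * (norm (u - v))\<^sup>2))"
    and Y: "finite Y" "Y \<subseteq> unit_cube" and G: "\<And>y. y \<in> Y \<Longrightarrow> G y = 0" and u: "u \<in> unit_cube"
    and norming: "\<And>p B. line_poly k p \<Longrightarrow> continuous_on UNIV p \<Longrightarrow> (\<And>y. y \<in> Y \<Longrightarrow> \<bar>p y\<bar> \<le> B) \<Longrightarrow> \<bar>p u\<bar> \<le> A * B"
  shows "cmod (G u) \<le> N * sqrt ((2 * b * real CARD('n)) ^ k / fact k * exp (2 * b * real CARD('n))) * (1 + sqrt (real (card Y)) * A)"
    (is "_ \<le> N * sqrt ?T * ?S")
proof (cases "u \<in> Y")
  case True
  have "0 \<le> N * sqrt ?T * ?S" using N A b by simp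
  then show ?thesis using G[OF True] by simp
next
  case False
  define V where "V = {p. line_poly k p \<and> continuous_on UNIV (p :: real ^ 'n \<Rightarrow> real)}"
  define F where "F = insert u Y"
  have F: "finite F" "F \<subseteq> unit_cube" using Y u by (auto simp: F_def)
  define W where "W = (\<lambda>(a, m) z. (z \<bullet> a) ^ m) ` (F \<times> {..<k})"
  have "\<exists>c. (\<forall>w\<in>W. (\<Sum>y\<in>Y. c y * w y) = w u) \<and> (\<Sum>y\<in>Y. (c y)\<^sup>2) \<le> A\<^sup>2"
  proof (rule norming_imp_quadrature[where V = V])
    show "finite W" unfolding W_def using F by auto
    show "W \<subseteq> V" unfolding W_def V_def by (auto intro!: line_poly_inner_power continuous_intros)
    show "(\<lambda>z. 0) \<in> V" by (auto simp: V_def line_poly_zero)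
    show "(\<lambda>z. p z + r z) \<in> V" if "p \<in> V" "r \<in> V" for p r
      using that by (auto simp: V_def intro!: line_poly_add continuous_intros)
    show "(\<lambda>z. c * p z) \<in> V" if "p \<in> V" for p c
      using that by (auto simp: V_def intro!: line_poly_scale continuous_intros)
    show "(p u)\<^sup>2 \<le> A\<^sup>2 * (\<Sum>y\<in>Y. (p y)\<^sup>2)" if p: "p \<in> V" for p
    proof -
      have "\<bar>p u\<bar> \<le> A * sqrt (\<Sum>y\<in>Y. (p y)\<^sup>2)"
      proof (rule norming)
        show "\<bar>p y\<bar> \<le> sqrt (\<Sum>y\<in>Y. (p y)\<^sup>2)" if "y \<in> Y" for y
        proof -
          have "(p y)\<^sup>2 \<le> (\<Sum>y\<in>Y. (p y)\<^sup>2)" using Y that by (intro member_le_sum) auto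
          then show ?thesis by (intro real_le_rsqrt) simp
        qed
      qed (use p in \<open>auto simp: V_def\<close>)
      then have "\<bar>p u\<bar>\<^sup>2 \<le> (A * sqrt (\<Sum>y\<in>Y. (p y)\<^sup>2))\<^sup>2" by (rule power_mono) simp
      then show ?thesis by (simp add: power_mult_distrib sum_nonneg)
    qed
  qed (use Y A in auto)
  then obtain c where c: "\<And>w. w \<in> W \<Longrightarrow> (\<Sum>y\<in>Y. c y * w y) = w u" and cA: "(\<Sum>y\<in>Y. (c y)\<^sup>2) \<le> A\<^sup>2" by blast
  define \<mu> where "\<mu> = (\<lambda>v. if v = u then 1 else - c v)"
  define l where "l = (\<lambda>v. \<mu> v * exp (b * (norm v)\<^sup>2))"
  have muY: "(\<Sum>v\<in>Y. \<mu> v * g v) = - (\<Sum>v\<in>Y. c v * g v)" for g :: "real ^ 'n \<Rightarrow> real"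
    unfolding sum_negf[symmetric] using False by (intro sum.cong) (auto simp: \<mu>_def)
  have muu: "\<mu> u = 1" by (simp add: \<mu>_def)
  have normF: "norm v \<le> sqrt (real CARD('n))" if "v \<in> F" for v
    using norm_le_sqrt_card[of v 1] F that by (auto simp: unit_cube_def)
  have "(\<Sum>v\<in>F. \<Sum>w\<in>F. l v * l w * exp (- b * (norm (v - w))\<^sup>2))
      \<le> (2 * b * (sqrt (real CARD('n)))\<^sup>2) ^ k / fact k * exp (2 * b * (sqrt (real CARD('n)))\<^sup>2) * (\<Sum>v\<in>F. \<bar>\<mu> v\<bar>)\<^sup>2"
    unfolding l_def
  proof (rule gaussian_form_annihilator[OF F(1) b k normF])
    fix m a assume "m < k" "a \<in> F"
    then have "(\<lambda>z. (z \<bullet> a) ^ m) \<in> W" unfolding W_def by force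
    from c[OF this] show "(\<Sum>v\<in>F. \<mu> v * (v \<bullet> a) ^ m) = 0"
      unfolding F_def sum.insert[OF Y(1) False] muY muu by simp
  qed
  also have "\<dots> \<le> ?T * ?S\<^sup>2"
  proof -
    have "(\<Sum>v\<in>Y. \<bar>c v\<bar> * 1)\<^sup>2 \<le> (\<Sum>v\<in>Y. \<bar>c v\<bar>\<^sup>2) * (\<Sum>v\<in>Y. 1\<^sup>2)" by (rule Cauchy_Schwarz_ineq_sum)
    also have "\<dots> \<le> A\<^sup>2 * real (card Y)" using cA by (simp add: mult_right_mono)
    also have "\<dots> = (sqrt (real (card Y)) * A)\<^sup>2" by (simp add: power_mult_distrib)
    finally have "(\<Sum>v\<in>Y. \<bar>c v\<bar> * 1) \<le> sqrt (real (card Y)) * A"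
      by (rule power2_le_imp_le) (use A in simp)
    then have "(\<Sum>v\<in>Y. \<bar>c v\<bar>) \<le> sqrt (real (card Y)) * A" by (simp only: mult_1_right)
    moreover have "(\<Sum>v\<in>Y. \<bar>\<mu> v\<bar>) = (\<Sum>v\<in>Y. \<bar>c v\<bar>)" using False by (intro sum.cong) (auto simp: \<mu>_def)
    moreover have "(\<Sum>v\<in>F. \<bar>\<mu> v\<bar>) = \<bar>\<mu> u\<bar> + (\<Sum>v\<in>Y. \<bar>\<mu> v\<bar>)"
      unfolding F_def by (rule sum.insert[OF Y(1) False])
    ultimately have "(\<Sum>v\<in>F. \<bar>\<mu> v\<bar>) \<le> ?S" using muu by linarith
    then have "(\<Sum>v\<in>F. \<bar>\<mu> v\<bar>)\<^sup>2 \<le> ?S\<^sup>2" by (intro power_mono sum_nonneg) auto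
    moreover have "?T \<ge> 0" using b by simp
    moreover have "(sqrt (real CARD('n)))\<^sup>2 = real CARD('n)" by simp
    ultimately show ?thesis by (simp only: mult_left_mono)
  qed
  finally have form: "(\<Sum>v\<in>F. \<Sum>w\<in>F. l v * l w * exp (- b * (norm (v - w))\<^sup>2)) \<le> ?T * ?S\<^sup>2" .
  have S0: "?S \<ge> 0" using A by simp
  have "cmod (G u) \<le> exp (b * (norm u)\<^sup>2) * cmod (G u)"
    using mult_right_mono[of 1 "exp (b * (norm u)\<^sup>2)" "cmod (G u)"] b by simp
  also have "\<dots> = cmod (\<Sum>v\<in>F. of_real (l v) * G v)"
  proof -
    have "(\<Sum>v\<in>Y. of_real (l v) * G v) = 0" using G by (intro sum.neutral) auto
    then have "(\<Sum>v\<in>F. of_real (l v) * G v) = of_real (exp (b * (norm u)\<^sup>2)) * G u"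
      unfolding F_def sum.insert[OF Y(1) False] by (simp add: l_def muu)
    then show ?thesis by (simp add: norm_mult)
  qed
  also have "\<dots> \<le> N * sqrt (\<Sum>v\<in>F. \<Sum>w\<in>F. l v * l w * exp (- b * (norm (v - w))\<^sup>2))" by (rule ev[OF F(1)])
  also have "\<dots> \<le> N * sqrt (?T * ?S\<^sup>2)" using form N by (intro mult_left_mono real_sqrt_le_mono)
  also have "sqrt (?T * ?S\<^sup>2) = sqrt ?T * ?S" using S0 by (simp only: real_sqrt_mult real_sqrt_abs abs_of_nonneg)
  finally show ?thesis by (simp only: mult.assoc)
qed

section \<open>Smooth bump functions\<close>

text \<open>The functions \<open>exp (- 1 / t) / t ^ j\<close> are needed for all \<open>j\<close> at once: the derivative of one of them is a
  combination of two others.\<close>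

definition flat_exp :: "nat \<Rightarrow> real \<Rightarrow> real" where
  "flat_exp j t = (if t > 0 then exp (- (1 / t)) / t ^ j else 0)"

lemma flat_exp_le:
  assumes "t > 0"
  shows "flat_exp j t \<le> fact (j + 2) * t\<^sup>2"
proof -
  have "(1 / t) ^ (j + 2) \<le> fact (j + 2) * exp (1 / t)" by (rule power_le_fact_exp) (use assms in simp)
  then have "1 \<le> fact (j + 2) * exp (1 / t) * t ^ (j + 2)"
    using assms by (simp add: power_one_over pos_divide_le_eq)
  then have "exp (- (1 / t)) * 1 \<le> exp (- (1 / t)) * (fact (j + 2) * exp (1 / t) * t ^ (j + 2))"
    by (intro mult_left_mono) auto
  also have "\<dots> = (exp (- (1 / t)) * exp (1 / t)) * (fact (j + 2) * t\<^sup>2 * t ^ j)"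
    by (simp only: power_add mult_ac)
  also have "exp (- (1 / t)) * exp (1 / t) = 1" by (simp flip: exp_add)
  finally have "exp (- (1 / t)) \<le> fact (j + 2) * t\<^sup>2 * t ^ j" by (simp only: mult_1_left mult_1_right)
  then show ?thesis using assms unfolding flat_exp_def by (simp add: pos_divide_le_eq)
qed

lemma flat_exp_nonneg: "flat_exp j t \<ge> 0" by (simp add: flat_exp_def)

lemma DERIV_flat_exp:
  "(flat_exp j has_real_derivative flat_exp (j + 2) t - real j * flat_exp (j + 1) t) (at t)"
proof -
  consider "t > 0" | "t < 0" | "t = 0" by linarith
  then show ?thesis
  proof cases
    case 1
    have "((\<lambda>s. exp (- (1 / s)) / s ^ j) has_real_derivative flat_exp (j + 2) t - real j * flat_exp (j + 1) t) (at t)"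
    proof (cases j)
      case 0
      then show ?thesis using 1
        by (auto intro!: derivative_eq_intros simp: flat_exp_def field_simps power2_eq_square)
    next
      case (Suc i)
      show ?thesis unfolding Suc using 1
        by (auto intro!: derivative_eq_intros simp del: power_Suc simp: flat_exp_def divide_simps)
           (simp add: algebra_simps power2_eq_square)
    qed
    moreover have "eventually (\<lambda>s. flat_exp j s = exp (- (1 / s)) / s ^ j) (nhds t)"
      using eventually_nhds_in_open[of "{0<..}" t] 1 by (auto elim!: eventually_mono simp: flat_exp_def)
    ultimately show ?thesis by (simp add: DERIV_cong_ev)
  next
    case 2
    have "eventually (\<lambda>s. flat_exp j s = 0) (nhds t)"
      using eventually_nhds_in_open[of "{..<0}" t] 2 by (auto elim!: eventually_mono simp: flat_exp_def)
    then show ?thesis using 2 by (simp add: DERIV_cong_ev flat_exp_def)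
  next
    case 3
    have "((\<lambda>h. (flat_exp j (0 + h) - flat_exp j 0) / h) \<longlongrightarrow> 0) (at 0)"
    proof (rule Lim_null_comparison)
      have "\<bar>(flat_exp j (0 + h) - flat_exp j 0) / h\<bar> \<le> fact (j + 2) * \<bar>h\<bar>" for h
      proof (cases "h > 0")
        case True
        then have "flat_exp j h / h \<le> fact (j + 2) * h\<^sup>2 / h"
          by (intro divide_right_mono flat_exp_le) auto
        then show ?thesis using True flat_exp_nonneg[of j h] by (simp add: flat_exp_def power2_eq_square)
      next
        case False
        moreover have "0 \<le> fact (j + 2) * \<bar>h\<bar>" by (intro mult_nonneg_nonneg) auto
        ultimately show ?thesis by (simp add: flat_exp_def)
      qed
      then show "\<forall>\<^sub>F h in at 0. norm ((flat_exp j (0 + h) - flat_exp j 0) / h) \<le> fact (j + 2) * \<bar>h\<bar>" by simp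
      show "((\<lambda>h::real. fact (j + 2) * \<bar>h\<bar>) \<longlongrightarrow> 0) (at 0)"
        by (auto intro!: tendsto_eq_intros)
    qed
    then show ?thesis unfolding 3 DERIV_def by (simp add: flat_exp_def)
  qed
qed

text \<open>A class of functions supported in the ball of radius \<open>r\<close> about \<open>a\<close> that is closed under directional
  derivatives, so that its members are smooth by a plain induction.\<close>

inductive_set bump_algebra :: "'a::real_inner \<Rightarrow> real \<Rightarrow> ('a \<Rightarrow> complex) set" for a r where
  base: "(\<lambda>x. of_real (flat_exp j (r\<^sup>2 - (norm (x - a))\<^sup>2))) \<in> bump_algebra a r"
| linear: "f \<in> bump_algebra a r \<Longrightarrow> (\<lambda>x. of_real ((x - a) \<bullet> v) * f x) \<in> bump_algebra a r"
| scale: "f \<in> bump_algebra a r \<Longrightarrow> (\<lambda>x. c * f x) \<in> bump_algebra a r"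
| add: "f \<in> bump_algebra a r \<Longrightarrow> g \<in> bump_algebra a r \<Longrightarrow> (\<lambda>x. f x + g x) \<in> bump_algebra a r"

lemma bump_algebra_derivative:
  assumes "f \<in> bump_algebra a r"
  shows "\<exists>D. (\<forall>x. (f has_derivative D x) (at x)) \<and> (\<forall>v. (\<lambda>x. D x v) \<in> bump_algebra a r)"
  using assms
proof induction
  case (base j)
  define q where "q = (\<lambda>x. r\<^sup>2 - (norm (x - a))\<^sup>2)"
  define D where "D = (\<lambda>x v. complex_of_real ((-2 * ((x - a) \<bullet> v)) * (flat_exp (j + 2) (q x) - real j * flat_exp (j + 1) (q x))))"
  have "((\<lambda>x. complex_of_real (flat_exp j (q x))) has_derivative D x) (at x)" for x
  proof -
    have "(q has_derivative (\<lambda>v. -2 * ((x - a) \<bullet> v))) (at x)"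
      unfolding q_def power2_norm_eq_inner
      by (auto intro!: derivative_eq_intros simp: inner_commute)
    from DERIV_compose_FDERIV[OF DERIV_flat_exp this]
    have "((\<lambda>x. flat_exp j (q x)) has_derivative
       (\<lambda>v. (-2 * ((x - a) \<bullet> v)) * (flat_exp (j + 2) (q x) - real j * flat_exp (j + 1) (q x)))) (at x)" .
    from has_derivative_of_real[OF this] show ?thesis unfolding D_def .
  qed
  moreover have "(\<lambda>x. D x v) \<in> bump_algebra a r" for v
  proof -
    have "(\<lambda>x. (-2) * (of_real ((x - a) \<bullet> v) * complex_of_real (flat_exp (j + 2) (r\<^sup>2 - (norm (x - a))\<^sup>2)))
        + (2 * of_nat j) * (of_real ((x - a) \<bullet> v) * complex_of_real (flat_exp (j + 1) (r\<^sup>2 - (norm (x - a))\<^sup>2)))) \<in> bump_algebra a r"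
      by (intro bump_algebra.intros)
    also have "(\<lambda>x. (-2) * (of_real ((x - a) \<bullet> v) * complex_of_real (flat_exp (j + 2) (r\<^sup>2 - (norm (x - a))\<^sup>2)))
        + (2 * of_nat j) * (of_real ((x - a) \<bullet> v) * complex_of_real (flat_exp (j + 1) (r\<^sup>2 - (norm (x - a))\<^sup>2)))) = (\<lambda>x. D x v)"
      by (rule ext) (simp add: D_def q_def algebra_simps)
    finally show ?thesis .
  qed
  ultimately show ?case unfolding q_def by (intro exI[of _ D]) auto
next
  case (linear f v)
  then obtain D where D: "\<And>x. (f has_derivative D x) (at x)" "\<And>v. (\<lambda>x. D x v) \<in> bump_algebra a r" by auto
  have "((\<lambda>x. of_real ((x - a) \<bullet> v) * f x) has_derivative
      (\<lambda>w. of_real ((x - a) \<bullet> v) * D x w + of_real (w \<bullet> v) * f x)) (at x)" for x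
  proof -
    have "((\<lambda>x. (x - a) \<bullet> v) has_derivative (\<lambda>w. w \<bullet> v)) (at x)"
      by (auto intro!: derivative_eq_intros)
    from has_derivative_mult[OF has_derivative_of_real[OF this] D(1)] show ?thesis .
  qed
  moreover have "(\<lambda>x. of_real ((x - a) \<bullet> v) * D x w + of_real (w \<bullet> v) * f x) \<in> bump_algebra a r" for w
    by (intro bump_algebra.intros D linear.hyps)
  ultimately show ?case
    by (intro exI[of _ "\<lambda>x w. of_real ((x - a) \<bullet> v) * D x w + of_real (w \<bullet> v) * f x"]) auto
next
  case (scale f c)
  then obtain D where D: "\<And>x. (f has_derivative D x) (at x)" "\<And>v. (\<lambda>x. D x v) \<in> bump_algebra a r" by auto
  have "((\<lambda>x. c * f x) has_derivative (\<lambda>w. c * D x w)) (at x)" for x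
    by (rule has_derivative_mult_right[OF D(1)])
  moreover have "(\<lambda>x. c * D x w) \<in> bump_algebra a r" for w
    by (intro bump_algebra.intros D)
  ultimately show ?case by (intro exI[of _ "\<lambda>x w. c * D x w"]) auto
next
  case (add f g)
  then obtain D E where D: "\<And>x. (f has_derivative D x) (at x)" "\<And>v. (\<lambda>x. D x v) \<in> bump_algebra a r"
    and E: "\<And>x. (g has_derivative E x) (at x)" "\<And>v. (\<lambda>x. E x v) \<in> bump_algebra a r" by auto
  have "((\<lambda>x. f x + g x) has_derivative (\<lambda>w. D x w + E x w)) (at x)" for x
    by (rule has_derivative_add[OF D(1) E(1)])
  moreover have "(\<lambda>x. D x w + E x w) \<in> bump_algebra a r" for w
    by (intro bump_algebra.intros D E)
  ultimately show ?case by (intro exI[of _ "\<lambda>x w. D x w + E x w"]) auto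
qed

lemma Ck_Suc_iff:
  "Ck (Suc k) f \<longleftrightarrow> (\<exists>D. (\<forall>x. (f has_derivative D x) (at x)) \<and> (\<forall>v. Ck k (\<lambda>x. D x v)))"
proof
  assume "Ck (Suc k) f"
  then show "\<exists>D. (\<forall>x. (f has_derivative D x) (at x)) \<and> (\<forall>v. Ck k (\<lambda>x. D x v))"
    by (intro exI[of _ "\<lambda>x. frechet_derivative f (at x)"]) (simp add: frechet_derivative_works[symmetric])
next
  assume "\<exists>D. (\<forall>x. (f has_derivative D x) (at x)) \<and> (\<forall>v. Ck k (\<lambda>x. D x v))"
  then obtain D where D: "\<And>x. (f has_derivative D x) (at x)" "\<And>v. Ck k (\<lambda>x. D x v)" by blast
  have "frechet_derivative f (at x) = D x" for x using frechet_derivative_at[OF D(1)] by simp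
  then show "Ck (Suc k) f" using D by (auto simp: differentiable_def)
qed

lemma bump_algebra_Ck: "f \<in> bump_algebra a r \<Longrightarrow> Ck k f"
proof (induction k arbitrary: f)
  case 0
  then show ?case using bump_algebra_derivative[OF 0]
    by (auto simp: continuous_on_eq_continuous_within intro: has_derivative_continuous)
next
  case (Suc k)
  then show ?case using bump_algebra_derivative[OF Suc.prems] unfolding Ck_Suc_iff by blast
qed

lemma Ck_add: "Ck k f \<Longrightarrow> Ck k g \<Longrightarrow> Ck k (\<lambda>x. f x + g x)"
proof (induction k arbitrary: f g)
  case 0 then show ?case by (auto intro: continuous_on_add)
next
  case (Suc k)
  obtain D E where "\<forall>x. (f has_derivative D x) (at x)" "\<forall>v. Ck k (\<lambda>x. D x v)"
    "\<forall>x. (g has_derivative E x) (at x)" "\<forall>v. Ck k (\<lambda>x. E x v)"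
    using Suc.prems unfolding Ck_Suc_iff by blast
  then show ?case unfolding Ck_Suc_iff
    by (intro exI[of _ "\<lambda>x v. D x v + E x v"]) (auto intro: has_derivative_add Suc.IH)
qed

lemma Ck_cmult:
  fixes c :: complex
  shows "Ck k f \<Longrightarrow> Ck k (\<lambda>x. c * f x)"
proof (induction k arbitrary: f)
  case 0 then show ?case by (auto intro: continuous_on_mult_left)
next
  case (Suc k)
  obtain D where "\<forall>x. (f has_derivative D x) (at x)" "\<forall>v. Ck k (\<lambda>x. D x v)"
    using Suc.prems unfolding Ck_Suc_iff by blast
  then show ?case unfolding Ck_Suc_iff
    by (intro exI[of _ "\<lambda>x v. c * D x v"]) (auto intro: has_derivative_mult_right Suc.IH)
qed

lemma Ck_zero: "Ck k (\<lambda>x. 0)"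
  by (induction k) (auto simp del: Ck.simps(2) simp: Ck_Suc_iff intro!: exI[of _ "\<lambda>x v. 0"])

lemma test_functionI:
  assumes "\<And>k. Ck k \<phi>" "compact K" "\<And>x. x \<notin> K \<Longrightarrow> \<phi> x = 0"
  shows "\<phi> \<in> test_functions"
proof -
  have "closure {x. \<phi> x \<noteq> 0} \<subseteq> K" using assms(2,3) by (intro closure_minimal) (auto dest: compact_imp_closed)
  then have "compact (closure {x. \<phi> x \<noteq> 0})"
    using assms(2) by (meson bounded_subset closure_subset compact_closure compact_imp_bounded order_trans)
  then show ?thesis using assms(1) by (simp add: test_functions_def)
qed

section \<open>Point evaluations on the native space\<close>

definition mollifier :: "real ^ 'n \<Rightarrow> real \<Rightarrow> (real ^ 'n \<Rightarrow> real) \<Rightarrow> bool" where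
  "mollifier a r w \<longleftrightarrow> (\<forall>x. w x \<ge> 0) \<and> (\<forall>x. w x \<noteq> 0 \<longrightarrow> x \<in> cball a r) \<and> continuous_on UNIV w \<and>
     integrable lborel w \<and> integral\<^sup>L lborel w = 1 \<and> (\<forall>k. Ck k (\<lambda>x. complex_of_real (w x)))"

lemma mollifierD:
  assumes "mollifier a r w"
  shows "w x \<ge> 0" "w x \<noteq> 0 \<Longrightarrow> x \<in> cball a r" "continuous_on UNIV w" "integrable lborel w"
    "integral\<^sup>L lborel w = 1" "Ck k (\<lambda>x. complex_of_real (w x))"
  using assms unfolding mollifier_def by simp_all

lemma mollifier_exists:
  fixes a :: "real ^ 'n"
  assumes r: "r > 0"
  shows "\<exists>w. mollifier a r w"
proof -
  define B where "B = (\<lambda>x. flat_exp 0 (r\<^sup>2 - (norm (x - a))\<^sup>2))"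
  have Balg: "(\<lambda>x. complex_of_real (B x)) \<in> bump_algebra a r" unfolding B_def by (rule bump_algebra.base)
  have B0: "B x \<ge> 0" for x by (simp add: B_def flat_exp_nonneg)
  have Bsupp: "x \<in> cball a r" if "B x \<noteq> 0" for x
  proof -
    have "r\<^sup>2 - (norm (x - a))\<^sup>2 > 0" using that by (auto simp: B_def flat_exp_def split: if_splits)
    then have "(norm (x - a))\<^sup>2 \<le> r\<^sup>2" by simp
    then have "norm (x - a) \<le> r" by (rule power2_le_imp_le) (use r in simp)
    then show ?thesis by (simp add: dist_norm norm_minus_commute)
  qed
  have Bcont: "continuous_on S B" for S
  proof -
    have "continuous_on UNIV (flat_exp 0)"
      using DERIV_isCont[OF DERIV_flat_exp] by (simp add: continuous_on_eq_continuous_within)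
    then have "continuous_on UNIV B" unfolding B_def
      by (rule continuous_on_compose2) (auto intro!: continuous_intros)
    then show ?thesis by (rule continuous_on_subset) simp
  qed
  have "integrable lborel (\<lambda>x. indicator (cball a r) x *\<^sub>R B x)"
    by (rule borel_integrable_compact) (auto intro: Bcont)
  moreover have "(\<lambda>x. indicator (cball a r) x *\<^sub>R B x) = B"
    using Bsupp by (intro ext) (auto simp: indicator_def)
  ultimately have Bint: "integrable lborel B" by simp
  define I where "I = integral\<^sup>L lborel B"
  have I: "I > 0"
  proof -
    define c where "c = exp (- (1 / (r\<^sup>2 * (3 / 4))))"
    have "c * measure lborel (ball a (r / 2)) = (LINT x|lborel. c * indicator (ball a (r / 2)) x)"
      by simp
    also have "\<dots> \<le> I" unfolding I_def
    proof (rule integral_mono)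
      show "integrable lborel (\<lambda>x. c * indicator (ball a (r / 2)) x)"
        by (intro integrable_mult_right integrable_real_indicator) (use emeasure_lborel_ball_finite[of a "r / 2"] in auto)
      fix x
      show "c * indicator (ball a (r / 2)) x \<le> B x"
      proof (cases "x \<in> ball a (r / 2)")
        case True
        then have "(norm (x - a))\<^sup>2 \<le> (r / 2)\<^sup>2"
          by (intro power_mono) (auto simp: dist_norm norm_minus_commute)
        then have t: "r\<^sup>2 * (3 / 4) \<le> r\<^sup>2 - (norm (x - a))\<^sup>2" by (simp add: power_divide)
        have pos: "0 < r\<^sup>2 * (3 / 4)" using r by simp
        have "0 < r\<^sup>2 - (norm (x - a))\<^sup>2" using t pos by linarith
        moreover have "1 / (r\<^sup>2 - (norm (x - a))\<^sup>2) \<le> 1 / (r\<^sup>2 * (3 / 4))"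
          by (rule frac_le[OF _ _ pos t]) simp_all
        ultimately have "c \<le> B x" unfolding c_def B_def flat_exp_def by simp
        then show ?thesis using True by simp
      qed (simp add: B0)
    qed (fact Bint)
    finally have "c * measure lborel (ball a (r / 2)) \<le> I" .
    moreover have "c * measure lborel (ball a (r / 2)) > 0" using r by (simp add: c_def content_ball_pos)
    ultimately show ?thesis by linarith
  qed
  show ?thesis
    unfolding mollifier_def
  proof (intro exI[of _ "\<lambda>x. B x / I"] conjI allI impI)
    show "B x / I \<ge> 0" for x using B0 I by simp
    show "x \<in> cball a r" if "B x / I \<noteq> 0" for x using Bsupp[of x] that by auto
    show "continuous_on UNIV (\<lambda>x. B x / I)" using I by (intro continuous_intros Bcont) auto
    show "integrable lborel (\<lambda>x. B x / I)" using Bint by simp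
    show "(LINT x|lborel. B x / I) = 1" using I by (simp add: I_def[symmetric])
    show "Ck k (\<lambda>x. complex_of_real (B x / I))" for k
      using Ck_cmult[OF bump_algebra_Ck[OF Balg], of k "1 / of_real I"] by simp
  qed
qed

lemma integrable_compact_support:
  fixes f :: "'a::euclidean_space \<Rightarrow> 'b::{banach, second_countable_topology}"
  assumes "continuous_on UNIV f" "compact K" "\<And>x. x \<notin> K \<Longrightarrow> f x = 0"
  shows "integrable lborel f"
proof -
  have "integrable lborel (\<lambda>x. indicator K x *\<^sub>R f x)"
    using assms by (intro borel_integrable_compact) (auto intro: continuous_on_subset)
  also have "(\<lambda>x. indicator K x *\<^sub>R f x) = f"
    using assms(3) by (intro ext) (auto simp: indicator_def)
  finally show ?thesis .
qed

lemma weighted_mean_close: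
  fixes f :: "'a \<Rightarrow> 'b::{banach, second_countable_topology}"
  assumes w: "\<And>x. w x \<ge> 0" "integrable M w" "integral\<^sup>L M w = 1"
    and int: "integrable M (\<lambda>x. w x *\<^sub>R f x)" and close: "\<And>x. w x \<noteq> 0 \<Longrightarrow> norm (f x - L) \<le> e"
  shows "norm ((LINT x|M. w x *\<^sub>R f x) - L) \<le> e"
proof -
  have intL: "integrable M (\<lambda>x. w x *\<^sub>R L)" using w by simp
  have "(LINT x|M. w x *\<^sub>R f x) - L = (LINT x|M. w x *\<^sub>R f x) - (LINT x|M. w x *\<^sub>R L)"
    using w by simp
  also have "\<dots> = (LINT x|M. w x *\<^sub>R (f x - L))"
    using int intL by (simp add: scaleR_diff_right)
  also have "norm \<dots> \<le> (LINT x|M. norm (w x *\<^sub>R (f x - L)))" by (rule integral_norm_bound)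
  also have "\<dots> \<le> (LINT x|M. e * w x)"
  proof (rule integral_mono)
    show "integrable M (\<lambda>x. norm (w x *\<^sub>R (f x - L)))"
      unfolding scaleR_diff_right by (intro integrable_norm Bochner_Integration.integrable_diff int intL)
    show "integrable M (\<lambda>x. e * w x)" using w by simp
    show "norm (w x *\<^sub>R (f x - L)) \<le> e * w x" for x
    proof (cases "w x = 0")
      case False
      then show ?thesis using mult_right_mono[OF close[OF False] w(1)[of x]] w(1)[of x]
        by (simp add: mult.commute)
    qed simp
  qed
  also have "\<dots> = e" using w by simp
  finally show ?thesis .
qed

lemma eventually_close_on_balls:
  fixes f :: "'a::real_normed_vector \<Rightarrow> 'b::real_normed_vector"
  assumes "continuous_on UNIV f" "e > 0"
  shows "eventually (\<lambda>r. \<forall>x. norm (x - a) \<le> 2 * r \<longrightarrow> norm (f x - f a) \<le> e) (at_right (0::real))"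
proof -
  obtain d where d: "d > 0" "\<And>x. dist x a < d \<Longrightarrow> dist (f x) (f a) < e"
    using assms unfolding continuous_on_iff by blast
  have "eventually (\<lambda>r. r \<in> {0<..<d / 2}) (at_right (0::real))"
    using d by (intro eventually_at_right_real) auto
  then show ?thesis
  proof (rule eventually_mono)
    fix r assume "r \<in> {0<..<d / 2}"
    then show "\<forall>x. norm (x - a) \<le> 2 * r \<longrightarrow> norm (f x - f a) \<le> e"
      using d(2) by (auto simp: dist_norm intro!: less_imp_le)
  qed
qed

text \<open>The native bound is tested on \<open>\<Phi> = (\<Sum>u\<in>F. l u * w u)\<close>, where the \<open>w u\<close> are mollifiers on balls so small
  that \<open>g\<close> and \<open>h\<close> change by at most \<open>e\<close>.\<close>

lemma native_bound_point_evaluations_approx: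
  fixes h :: "real ^ 'n \<Rightarrow> real" and g :: "real ^ 'n \<Rightarrow> complex" and l :: "real ^ 'n \<Rightarrow> real"
  assumes h: "continuous_on UNIV h" and h1: "\<And>x. \<bar>h x\<bar> \<le> 1"
    and g: "continuous_on UNIV g" and N: "native_bound h g N" and F: "finite F" and e: "e > 0"
  defines "\<Lambda> \<equiv> \<Sum>u\<in>F. \<bar>l u\<bar>"
  shows "cmod (\<Sum>u\<in>F. of_real (l u) * g u)
      \<le> e * \<Lambda> + N * sqrt ((\<Sum>u\<in>F. \<Sum>v\<in>F. l u * l v * h (u - v)) + e * \<Lambda> * \<Lambda>)"
proof -
  have "eventually (\<lambda>r. (\<forall>u\<in>F. \<forall>x. norm (x - u) \<le> 2 * r \<longrightarrow> norm (g x - g u) \<le> e) \<and>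
      (\<forall>u\<in>F. \<forall>v\<in>F. \<forall>x. norm (x - (u - v)) \<le> 2 * r \<longrightarrow> norm (h x - h (u - v)) \<le> e) \<and> r > 0) (at_right (0::real))"
    using F e by (intro eventually_conj eventually_ball_finite ballI eventually_close_on_balls g h eventually_at_right_less)
  then obtain r where rg: "\<And>u x. u \<in> F \<Longrightarrow> norm (x - u) \<le> 2 * r \<Longrightarrow> norm (g x - g u) \<le> e"
    and rh: "\<And>u v x. u \<in> F \<Longrightarrow> v \<in> F \<Longrightarrow> norm (x - (u - v)) \<le> 2 * r \<Longrightarrow> norm (h x - h (u - v)) \<le> e"
    and r: "r > 0"
    using eventually_happens'[OF trivial_limit_at_right_real] by blast
  have "\<forall>u :: real ^ 'n. \<exists>w. mollifier u r w" using mollifier_exists[OF r] by blast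
  from choice[OF this] obtain w :: "real ^ 'n \<Rightarrow> real ^ 'n \<Rightarrow> real" where "\<And>u. mollifier u r (w u)" by blast
  note w0 = mollifierD(1)[OF this] and wsupp = mollifierD(2)[OF this] and wcont = mollifierD(3)[OF this]
    and wint = mollifierD(4)[OF this] and w1 = mollifierD(5)[OF this] and wCk = mollifierD(6)[OF this]
  have w_int: "integrable lborel (\<lambda>x. w u x *\<^sub>R f x)" if "continuous_on UNIV f"
    for u and f :: "real ^ 'n \<Rightarrow> 'b::{banach, second_countable_topology}"
    using wsupp[of u] by (intro integrable_compact_support[of _ "cball u r"] continuous_intros wcont that) auto
  define \<Phi> where "\<Phi> = (\<lambda>x. \<Sum>u\<in>F. l u * w u x)"
  have \<Phi>cont: "continuous_on UNIV \<Phi>" unfolding \<Phi>_def by (intro continuous_intros wcont)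
  have \<Phi>int: "integrable lborel \<Phi>" unfolding \<Phi>_def by (intro Bochner_Integration.integrable_sum integrable_mult_right wint)
  have test: "(\<lambda>x. complex_of_real (\<Phi> x)) \<in> test_functions"
  proof (rule test_functionI[of _ "\<Union>u\<in>F. cball u r"])
    show "Ck k (\<lambda>x. complex_of_real (\<Phi> x))" for k
    proof -
      have "Ck k (\<lambda>x. \<Sum>u\<in>F. of_real (l u) * complex_of_real (w u x))" using F
        by (induction F) (simp_all add: Ck_zero Ck_add Ck_cmult wCk)
      then show ?thesis by (simp add: \<Phi>_def)
    qed
    show "compact (\<Union>u\<in>F. cball u r)" using F by (intro compact_UN) auto
    show "complex_of_real (\<Phi> x) = 0" if "x \<notin> (\<Union>u\<in>F. cball u r)" for x
      using that wsupp unfolding \<Phi>_def of_real_eq_0_iff by (intro sum.neutral) fastforce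
  qed
  define K where "K = (\<lambda>y. LINT x|lborel. h (x - y) * \<Phi> x)"
  have hm: "h \<in> borel_measurable borel" using h by (rule borel_measurable_continuous_onI)
  have \<Phi>m: "\<Phi> \<in> borel_measurable borel" using \<Phi>cont by (rule borel_measurable_continuous_onI)
  have hw: "integrable lborel (\<lambda>x. w u x *\<^sub>R h (x - y))" for u y
    by (intro w_int continuous_on_compose2[OF h]) (auto intro!: continuous_intros)
  have h\<Phi>: "integrable lborel (\<lambda>x. h (x - y) * \<Phi> x)" for y
  proof -
    have "integrable lborel (\<lambda>x. \<Sum>u\<in>F. l u * (w u x *\<^sub>R h (x - y)))"
      by (intro Bochner_Integration.integrable_sum integrable_mult_right hw)
    then show ?thesis by (simp add: \<Phi>_def sum_distrib_left mult_ac)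
  qed
  have K_eq: "K y = (\<Sum>u\<in>F. l u * (LINT x|lborel. w u x *\<^sub>R h (x - y)))" for y
  proof -
    have "K y = (LINT x|lborel. (\<Sum>u\<in>F. l u * (w u x *\<^sub>R h (x - y))))"
      unfolding K_def \<Phi>_def by (simp add: sum_distrib_left mult_ac)
    also have "\<dots> = (\<Sum>u\<in>F. LINT x|lborel. l u * (w u x *\<^sub>R h (x - y)))"
      by (intro Bochner_Integration.integral_sum integrable_mult_right hw)
    finally show ?thesis by simp
  qed
  have Km: "K \<in> borel_measurable lborel"
    unfolding K_def
  proof (rule lborel.borel_measurable_lebesgue_integral)
    show "(\<lambda>(y, x). h (x - y) * \<Phi> x) \<in> borel_measurable (lborel \<Otimes>\<^sub>M lborel)"
      using hm \<Phi>m by measurable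
  qed
  have Kbound: "\<bar>K y\<bar> \<le> (LINT x|lborel. \<bar>\<Phi> x\<bar>)" for y
  proof -
    have "\<bar>K y\<bar> \<le> (LINT x|lborel. \<bar>h (x - y) * \<Phi> x\<bar>)" unfolding K_def by (rule integral_abs_bound)
    also have "\<dots> \<le> (LINT x|lborel. \<bar>\<Phi> x\<bar>)"
    proof (rule integral_mono)
      show "\<bar>h (x - y) * \<Phi> x\<bar> \<le> \<bar>\<Phi> x\<bar>" for x
        unfolding abs_mult using mult_right_mono[OF h1[of "x - y"] abs_ge_zero[of "\<Phi> x"]] by simp
    qed (use \<Phi>int h\<Phi> in auto)
    finally show ?thesis .
  qed
  have wK: "integrable lborel (\<lambda>y. w v y *\<^sub>R K y)" for v
  proof (rule Bochner_Integration.integrable_bound)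
    show "integrable lborel (\<lambda>y. (LINT x|lborel. \<bar>\<Phi> x\<bar>) * w v y)" using wint by simp
    show "(\<lambda>y. w v y *\<^sub>R K y) \<in> borel_measurable lborel"
      using Km borel_measurable_integrable[OF wint[of v]] by measurable
    show "AE y in lborel. norm (w v y *\<^sub>R K y) \<le> norm ((LINT x|lborel. \<bar>\<Phi> x\<bar>) * w v y)"
    proof (rule AE_I2)
      fix y
      have "norm (w v y *\<^sub>R K y) = \<bar>K y\<bar> * w v y" using w0 by (simp add: abs_mult)
      also have "\<dots> \<le> (LINT x|lborel. \<bar>\<Phi> x\<bar>) * w v y" by (intro mult_right_mono Kbound w0)
      finally show "norm (w v y *\<^sub>R K y) \<le> norm ((LINT x|lborel. \<bar>\<Phi> x\<bar>) * w v y)" by simp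
    qed
  qed
  define S where "S = (\<Sum>u\<in>F. \<Sum>v\<in>F. l u * l v * h (u - v))"
  have qf: "quadratic_form h (\<lambda>x. complex_of_real (\<Phi> x)) = of_real (\<Sum>v\<in>F. l v * (LINT y|lborel. w v y *\<^sub>R K y))"
  proof -
    have "quadratic_form h (\<lambda>x. complex_of_real (\<Phi> x)) = (LINT y|lborel. complex_of_real (K y * \<Phi> y))"
      unfolding quadratic_form_def
    proof (rule Bochner_Integration.integral_cong)
      fix y
      have "(LINT x|lborel. complex_of_real (h (x - y)) * complex_of_real (\<Phi> x) * cnj (complex_of_real (\<Phi> y)))
          = (LINT x|lborel. complex_of_real (h (x - y) * \<Phi> x * \<Phi> y))" by simp
      also have "\<dots> = complex_of_real (LINT x|lborel. h (x - y) * \<Phi> x * \<Phi> y)" by (rule integral_complex_of_real)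
      also have "(LINT x|lborel. h (x - y) * \<Phi> x * \<Phi> y) = K y * \<Phi> y"
        unfolding K_def by simp
      finally show "(LINT x|lborel. complex_of_real (h (x - y)) * complex_of_real (\<Phi> x) * cnj (complex_of_real (\<Phi> y)))
          = complex_of_real (K y * \<Phi> y)" .
    qed simp
    also have "\<dots> = complex_of_real (LINT y|lborel. K y * \<Phi> y)" by (rule integral_complex_of_real)
    also have "(LINT y|lborel. K y * \<Phi> y) = (LINT y|lborel. (\<Sum>v\<in>F. l v * (w v y *\<^sub>R K y)))"
      unfolding \<Phi>_def by (simp add: sum_distrib_left mult_ac)
    also have "\<dots> = (\<Sum>v\<in>F. LINT y|lborel. l v * (w v y *\<^sub>R K y))"
      by (intro Bochner_Integration.integral_sum integrable_mult_right wK)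
    finally show ?thesis by simp
  qed
  have Kclose: "\<bar>K y - (\<Sum>u\<in>F. l u * h (u - v))\<bar> \<le> e * \<Lambda>" if "v \<in> F" "w v y \<noteq> 0" for v y
  proof -
    have "norm ((LINT x|lborel. w u x *\<^sub>R h (x - y)) - h (u - v)) \<le> e" if u: "u \<in> F" for u
    proof (rule weighted_mean_close[OF w0 wint w1 hw])
      fix x assume "w u x \<noteq> 0"
      then have "norm (x - u) \<le> r" "norm (y - v) \<le> r"
        using wsupp[of u x] wsupp[OF \<open>w v y \<noteq> 0\<close>] by (auto simp: dist_norm norm_minus_commute)
      moreover have "(x - y) - (u - v) = (x - u) - (y - v)" by simp
      ultimately have "norm ((x - y) - (u - v)) \<le> 2 * r"
        using norm_triangle_ineq4[of "x - u" "y - v"] by (simp only:)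
      then show "norm (h (x - y) - h (u - v)) \<le> e" by (rule rh[OF u \<open>v \<in> F\<close>])
    qed
    then have "\<bar>l u * ((LINT x|lborel. w u x *\<^sub>R h (x - y)) - h (u - v))\<bar> \<le> \<bar>l u\<bar> * e" if "u \<in> F" for u
      unfolding abs_mult using that by (intro mult_left_mono) auto
    then have "\<bar>\<Sum>u\<in>F. l u * ((LINT x|lborel. w u x *\<^sub>R h (x - y)) - h (u - v))\<bar> \<le> (\<Sum>u\<in>F. \<bar>l u\<bar> * e)"
      by (intro order_trans[OF sum_abs] sum_mono)
    then show ?thesis unfolding K_eq \<Lambda>_def by (simp add: right_diff_distrib sum_subtractf sum_distrib_left mult.commute)
  qed
  have "\<bar>(\<Sum>v\<in>F. l v * (LINT y|lborel. w v y *\<^sub>R K y)) - S\<bar> \<le> e * \<Lambda> * \<Lambda>"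
  proof -
    have "norm ((LINT y|lborel. w v y *\<^sub>R K y) - (\<Sum>u\<in>F. l u * h (u - v))) \<le> e * \<Lambda>" if "v \<in> F" for v
      using Kclose[OF that] by (intro weighted_mean_close[OF w0 wint w1 wK]) auto
    then have "\<bar>l v * ((LINT y|lborel. w v y *\<^sub>R K y) - (\<Sum>u\<in>F. l u * h (u - v)))\<bar> \<le> \<bar>l v\<bar> * (e * \<Lambda>)" if "v \<in> F" for v
      unfolding abs_mult using that by (intro mult_left_mono) auto
    then have "\<bar>\<Sum>v\<in>F. l v * ((LINT y|lborel. w v y *\<^sub>R K y) - (\<Sum>u\<in>F. l u * h (u - v)))\<bar> \<le> (\<Sum>v\<in>F. \<bar>l v\<bar> * (e * \<Lambda>))"
      by (intro order_trans[OF sum_abs] sum_mono)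
    also have "(\<Sum>v\<in>F. \<bar>l v\<bar> * (e * \<Lambda>)) = e * \<Lambda> * \<Lambda>" unfolding \<Lambda>_def by (simp add: sum_distrib_right[symmetric])
    also have "(\<Sum>v\<in>F. l v * ((LINT y|lborel. w v y *\<^sub>R K y) - (\<Sum>u\<in>F. l u * h (u - v))))
        = (\<Sum>v\<in>F. l v * (LINT y|lborel. w v y *\<^sub>R K y)) - (\<Sum>v\<in>F. \<Sum>u\<in>F. l u * l v * h (u - v))"
      by (simp add: right_diff_distrib sum_subtractf sum_distrib_left mult_ac)
    also have "(\<Sum>v\<in>F. \<Sum>u\<in>F. l u * l v * h (u - v)) = S" unfolding S_def by (rule sum.swap)
    finally show ?thesis .
  qed
  then have "Re (quadratic_form h (\<lambda>x. complex_of_real (\<Phi> x))) \<le> S + e * \<Lambda> * \<Lambda>" unfolding qf by simp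
  moreover have "cmod (LINT x|lborel. g x * complex_of_real (\<Phi> x))
      \<le> N * sqrt (Re (quadratic_form h (\<lambda>x. complex_of_real (\<Phi> x))))" and "N \<ge> 0"
    using N test unfolding native_bound_def by auto
  ultimately have upper: "cmod (LINT x|lborel. g x * complex_of_real (\<Phi> x)) \<le> N * sqrt (S + e * \<Lambda> * \<Lambda>)"
    by (meson mult_left_mono order_trans real_sqrt_le_mono)
  have g\<Phi>: "(LINT x|lborel. g x * complex_of_real (\<Phi> x)) = (\<Sum>u\<in>F. of_real (l u) * (LINT x|lborel. w u x *\<^sub>R g x))"
  proof -
    have "(LINT x|lborel. g x * complex_of_real (\<Phi> x)) = (LINT x|lborel. (\<Sum>u\<in>F. of_real (l u) * (w u x *\<^sub>R g x)))"
      unfolding \<Phi>_def by (simp add: sum_distrib_left scaleR_conv_of_real mult_ac)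
    also have "\<dots> = (\<Sum>u\<in>F. LINT x|lborel. of_real (l u) * (w u x *\<^sub>R g x))"
      by (intro Bochner_Integration.integral_sum integrable_mult_right w_int g)
    finally show ?thesis by (simp only: integral_mult_right_zero)
  qed
  have "cmod ((\<Sum>u\<in>F. of_real (l u) * g u) - (\<Sum>u\<in>F. of_real (l u) * (LINT x|lborel. w u x *\<^sub>R g x))) \<le> e * \<Lambda>"
  proof -
    have "cmod (of_real (l u) * g u - of_real (l u) * (LINT x|lborel. w u x *\<^sub>R g x)) \<le> \<bar>l u\<bar> * e" if u: "u \<in> F" for u
    proof -
      have "norm ((LINT x|lborel. w u x *\<^sub>R g x) - g u) \<le> e"
      proof (rule weighted_mean_close[OF w0 wint w1 w_int[OF g]])
        fix x assume "w u x \<noteq> 0"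
        then have "norm (x - u) \<le> 2 * r" using wsupp[of u x] r by (auto simp: dist_norm norm_minus_commute)
        then show "norm (g x - g u) \<le> e" by (rule rg[OF u])
      qed
      then have "\<bar>l u\<bar> * norm (g u - (LINT x|lborel. w u x *\<^sub>R g x)) \<le> \<bar>l u\<bar> * e"
        by (intro mult_left_mono) (auto simp: norm_minus_commute)
      then show ?thesis unfolding right_diff_distrib[symmetric] norm_mult by simp
    qed
    then have "cmod (\<Sum>u\<in>F. of_real (l u) * g u - of_real (l u) * (LINT x|lborel. w u x *\<^sub>R g x)) \<le> (\<Sum>u\<in>F. \<bar>l u\<bar> * e)"
      by (intro order_trans[OF norm_sum] sum_mono)
    then show ?thesis by (simp add: sum_subtractf \<Lambda>_def sum_distrib_left mult.commute)
  qed
  then show ?thesis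
    using upper[unfolded g\<Phi>] norm_triangle_sub[of "\<Sum>u\<in>F. of_real (l u) * g u" "\<Sum>u\<in>F. of_real (l u) * (LINT x|lborel. w u x *\<^sub>R g x)"]
    unfolding S_def by linarith
qed

text \<open>The bound by the quadratic form extends from test functions to finite combinations of point
  masses; this is all that is used about the native space.\<close>

lemma native_bound_point_evaluations:
  fixes h :: "real ^ 'n \<Rightarrow> real" and g :: "real ^ 'n \<Rightarrow> complex"
  assumes h: "continuous_on UNIV h" and h1: "\<And>x. \<bar>h x\<bar> \<le> 1"
    and g: "continuous_on UNIV g" and N: "native_bound h g N" and F: "finite F"
  shows "cmod (\<Sum>u\<in>F. of_real (l u) * g u) \<le> N * sqrt (\<Sum>u\<in>F. \<Sum>v\<in>F. l u * l v * h (u - v))"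
proof -
  define \<Lambda> where "\<Lambda> = (\<Sum>u\<in>F. \<bar>l u\<bar>)"
  define S where "S = (\<Sum>u\<in>F. \<Sum>v\<in>F. l u * l v * h (u - v))"
  have "((\<lambda>e. e * \<Lambda> + N * sqrt (S + e * \<Lambda> * \<Lambda>)) \<longlongrightarrow> 0 * \<Lambda> + N * sqrt (S + 0 * \<Lambda> * \<Lambda>)) (at_right 0)"
    by (intro tendsto_intros)
  moreover have "eventually (\<lambda>e. cmod (\<Sum>u\<in>F. of_real (l u) * g u) \<le> e * \<Lambda> + N * sqrt (S + e * \<Lambda> * \<Lambda>)) (at_right 0)"
    using native_bound_point_evaluations_approx[OF h h1 g N F, where l = l, folded S_def \<Lambda>_def]
    by (intro eventually_mono[OF eventually_at_right_less[of 0]]) auto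
  ultimately have "cmod (\<Sum>u\<in>F. of_real (l u) * g u) \<le> 0 * \<Lambda> + N * sqrt (S + 0 * \<Lambda> * \<Lambda>)"
    by (rule tendsto_lowerbound) simp
  then show ?thesis by (simp add: S_def)
qed

text \<open>The admissible constants form a closed set, so the least one exists.\<close>

lemma native_bound_native_norm:
  assumes "f \<in> native_space h"
  shows "native_bound h f (native_norm h f)"
proof -
  define S where "S = {c. native_bound h f c}"
  have ne: "S \<noteq> {}" using assms by (auto simp: native_space_def S_def)
  have bdd: "bdd_below S" unfolding S_def native_bound_def by (intro bdd_belowI[of _ 0]) auto
  have "S = {0..} \<inter> (\<Inter>\<phi>\<in>test_functions. {c. cmod (LINT x|lborel. f x * \<phi> x) \<le> c * sqrt (Re (quadratic_form h \<phi>))})"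
    by (auto simp: S_def native_bound_def)
  moreover have "closed {c. cmod (LINT x|lborel. f x * \<phi> x) \<le> c * sqrt (Re (quadratic_form h \<phi>))}" for \<phi>
    by (intro closed_Collect_le continuous_intros)
  ultimately have "closed S" by (auto intro!: closed_Int closed_INT)
  then have "Inf S \<in> S" using closed_contains_Inf[OF ne bdd] by blast
  moreover have "native_norm h f = Inf S"
    unfolding native_norm_def
  proof (rule Least_equality)
    show "native_bound h f (Inf S)" using \<open>Inf S \<in> S\<close> by (simp add: S_def)
    show "Inf S \<le> c" if "native_bound h f c" for c using that bdd by (intro cInf_lower) (simp_all add: S_def)
  qed
  ultimately show ?thesis by (simp add: S_def)
qed

lemma native_bound_diff:
  fixes f s :: "real ^ 'n \<Rightarrow> complex"
  assumes f: "continuous_on UNIV f" "native_bound h f c" and s: "continuous_on UNIV s" "native_bound h s c'"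
  shows "native_bound h (\<lambda>x. f x - s x) (c + c')"
  unfolding native_bound_def
proof (intro conjI ballI)
  show "0 \<le> c + c'" using f(2) s(2) by (simp add: native_bound_def)
  fix \<phi> :: "real ^ 'n \<Rightarrow> complex" assume \<phi>: "\<phi> \<in> test_functions"
  then have "Ck 0 \<phi>" and K: "compact (closure {x. \<phi> x \<noteq> 0})" by (simp_all add: test_functions_def del: Ck.simps)
  then have cont: "continuous_on UNIV \<phi>" by simp
  have int: "integrable lborel (\<lambda>x. g x * \<phi> x)" if "continuous_on UNIV g" for g :: "real ^ 'n \<Rightarrow> complex"
    using K by (rule integrable_compact_support[OF continuous_on_mult[OF that cont]])
      (use closure_subset[of "{x. \<phi> x \<noteq> 0}"] in auto)
  have "(LINT x|lborel. (f x - s x) * \<phi> x) = (LINT x|lborel. f x * \<phi> x) - (LINT x|lborel. s x * \<phi> x)"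
    using int[OF f(1)] int[OF s(1)] by (simp add: left_diff_distrib)
  then have "cmod (LINT x|lborel. (f x - s x) * \<phi> x)
      \<le> cmod (LINT x|lborel. f x * \<phi> x) + cmod (LINT x|lborel. s x * \<phi> x)"
    by (simp add: norm_triangle_ineq4)
  also have "\<dots> \<le> c * sqrt (Re (quadratic_form h \<phi>)) + c' * sqrt (Re (quadratic_form h \<phi>))"
    using f(2) s(2) \<phi> unfolding native_bound_def by (intro add_mono) auto
  finally show "cmod (LINT x|lborel. (f x - s x) * \<phi> x) \<le> (c + c') * sqrt (Re (quadratic_form h \<phi>))"
    by (simp add: distrib_right)
qed

text \<open>The constant is produced as the sum of the norms of \<open>f\<close> and \<open>s\<close> rather than as
  \<open>2 * native_norm h f\<close>: a larger constant gives a weaker bound only where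
  the quadratic form is nonnegative.\<close>

lemma native_bound_spline_error:
  assumes f: "f \<in> native_space h" and s: "is_spline h X f s"
  obtains N where "native_bound h (\<lambda>x. f x - s x) N" "N \<le> 2 * native_norm h f"
proof
  have s': "s \<in> native_space h" "native_norm h s \<le> native_norm h f"
    using s f unfolding is_spline_def by auto
  show "native_bound h (\<lambda>x. f x - s x) (native_norm h f + native_norm h s)"
    using f s' by (intro native_bound_diff native_bound_native_norm) (auto simp: native_space_def)
  show "native_norm h f + native_norm h s \<le> 2 * native_norm h f" using s' by simp
qed

section \<open>The error estimate\<close>

text \<open>With \<open>u = 1 / d\<close> the logarithm of the left side is \<open>- (\<eta> / 2) * u * ln u\<close> up to \<open>O(u)\<close>, and that of the
  right side is \<open>- c * u * ln u\<close> up to \<open>O(u)\<close>. The factor \<open>9 / 10\<close> hidden in \<open>9 / 20\<close> absorbs the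
  rounding of \<open>k\<close>, and the constants \<open>K\<close>, \<open>L\<close>, \<open>C\<close> and \<open>\<Delta>\<close> affect only lower order terms.\<close>

lemma superexponential_decay:
  fixes \<eta> c C \<Delta> K L :: real
  assumes pos: "\<eta> > 0" "C > 0" "\<Delta> > 0" "K > 0" "L \<ge> 1" and c: "c < 9 / 20 * \<eta>"
  obtains d\<^sub>0 where "d\<^sub>0 > 0" "\<And>d k. 0 < d \<Longrightarrow> d \<le> d\<^sub>0 \<Longrightarrow> real k \<le> \<eta> / d \<Longrightarrow> \<eta> / d - 2 \<le> real k \<Longrightarrow>
    K * L ^ k / sqrt (fact k) \<le> \<Delta> * (C * d) powr (c / d)"
proof -
  define \<epsilon> where "\<epsilon> = 9 / 20 * \<eta> - c"
  have \<epsilon>: "\<epsilon> > 0" using c by (simp add: \<epsilon>_def)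
  define a where "a = \<bar>ln K - ln \<Delta>\<bar>"
  define b where "b = \<bar>\<eta> * (ln L + 1 / 2) - 9 / 20 * \<eta> * ln (9 / 10 * \<eta>) - c * ln C\<bar>"
  define u\<^sub>0 where "u\<^sub>0 = max (20 / \<eta>) (exp ((a + b) / \<epsilon>))"
  have u0: "u\<^sub>0 > 0" using exp_gt_zero[of "(a + b) / \<epsilon>"] unfolding u\<^sub>0_def by linarith
  show ?thesis
  proof (rule that[of "1 / u\<^sub>0"])
    show "1 / u\<^sub>0 > 0" using u0 by simp
    fix d :: real and k :: nat
    assume d: "0 < d" "d \<le> 1 / u\<^sub>0" and k: "real k \<le> \<eta> / d" "\<eta> / d - 2 \<le> real k"
    define u where "u = 1 / d"
    have "u\<^sub>0 \<le> u" using d u0 by (simp add: u_def field_simps)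
    then have u1: "20 / \<eta> \<le> u" and u2: "exp ((a + b) / \<epsilon>) \<le> u" by (simp_all add: u\<^sub>0_def)
    have "0 \<le> (a + b) / \<epsilon>" using \<epsilon> by (simp add: a_def b_def)
    then have "1 \<le> exp ((a + b) / \<epsilon>)" by simp
    then have u_ge1: "u \<ge> 1" using u2 by linarith
    have lnu: "(a + b) / \<epsilon> \<le> ln u" using u2 u_ge1 by (simp add: ln_ge_iff)
    have \<eta>u: "20 \<le> \<eta> * u" using u1 pos by (simp add: field_simps)
    have k': "real k \<le> \<eta> * u" "\<eta> * u - 2 \<le> real k" using k by (simp_all add: u_def)
    have k9: "9 / 10 * (\<eta> * u) \<le> real k" using k' \<eta>u by linarith
    then have k1: "real k \<ge> 1" using \<eta>u by linarith
    have "real k * ln (real k) - real k \<le> ln (fact k)"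
    proof -
      have "real k ^ k \<le> fact k * exp (real k)" by (rule power_le_fact_exp) simp
      then have "ln (real k ^ k) \<le> ln (fact k * exp (real k))"
        using k1 by (subst ln_le_cancel_iff) auto
      then show ?thesis using k1 by (simp add: ln_mult ln_realpow)
    qed
    moreover have "9 / 10 * (\<eta> * u) * ln (9 / 10 * (\<eta> * u)) \<le> real k * ln (real k)"
      using k9 \<eta>u k1 by (intro mult_mono) auto
    moreover have "real k * (ln L + 1 / 2) \<le> \<eta> * u * (ln L + 1 / 2)"
      using k' pos by (intro mult_right_mono) auto
    ultimately have "ln K + real k * ln L - ln (fact k) / 2
        \<le> ln K + \<eta> * u * (ln L + 1 / 2) - 9 / 20 * (\<eta> * u) * ln (9 / 10 * (\<eta> * u))"
      by (simp add: algebra_simps)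
    also have "ln (9 / 10 * (\<eta> * u)) = ln (9 / 10 * \<eta>) + ln u"
      using pos u_ge1 ln_mult[of "9 / 10 * \<eta>" u] by (simp add: mult.assoc)
    also have "ln K + \<eta> * u * (ln L + 1 / 2) - 9 / 20 * (\<eta> * u) * (ln (9 / 10 * \<eta>) + ln u)
        = ln \<Delta> + c * u * (ln C - ln u) + (ln K - ln \<Delta>)
          + u * (\<eta> * (ln L + 1 / 2) - 9 / 20 * \<eta> * ln (9 / 10 * \<eta>) - c * ln C) - \<epsilon> * u * ln u"
      by (simp add: \<epsilon>_def algebra_simps)
    also have "\<dots> \<le> ln \<Delta> + c * u * (ln C - ln u)"
    proof -
      have "ln K - ln \<Delta> \<le> a * u" using mult_left_mono[OF u_ge1, of a] by (simp add: a_def)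
      moreover have "u * (\<eta> * (ln L + 1 / 2) - 9 / 20 * \<eta> * ln (9 / 10 * \<eta>) - c * ln C) \<le> u * b"
        using u_ge1 unfolding b_def by (intro mult_left_mono) auto
      moreover have "(a + b) * u \<le> \<epsilon> * u * ln u"
        using mult_right_mono[OF lnu, of "\<epsilon> * u"] \<epsilon> u_ge1 by (simp add: mult_ac)
      ultimately show ?thesis by (simp add: algebra_simps)
    qed
    finally have le: "ln K + real k * ln L - ln (fact k) / 2 \<le> ln \<Delta> + c * u * (ln C - ln u)" .
    have "K * L ^ k / sqrt (fact k) = exp (ln K + real k * ln L - ln (fact k) / 2)"
      using pos by (simp add: exp_add exp_diff exp_of_nat_mult ln_sqrt[symmetric])
    also have "\<dots> \<le> exp (ln \<Delta> + c * u * (ln C - ln u))" using le by simp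
    also have "ln C - ln u = ln (C * d)" using pos d by (simp add: u_def ln_mult ln_div)
    also have "exp (ln \<Delta> + c * u * ln (C * d)) = \<Delta> * (C * d) powr (c / d)"
      using pos d by (simp add: exp_add powr_def u_def)
    finally show "K * L ^ k / sqrt (fact k) \<le> \<Delta> * (C * d) powr (c / d)" .
  qed
qed

lemma norm_rotation:
  fixes R :: "real ^ 'n ^ 'n"
  assumes "rotation_matrix R"
  shows "norm (R *v x) = norm x"
proof -
  have "orthogonal_transformation ((*v) R)"
    using assms by (simp add: rotation_matrix_def orthogonal_transformation_matrix)
  then show ?thesis by (rule orthogonal_transformation_norm)
qed

text \<open>A subcube of side \<open>b\<^sub>0\<close> of \<open>E\<close> that contains \<open>x\<close> is the image of \<open>[-1, 1] ^ n\<close> under a similarity \<open>\<Psi>\<close>,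
  which changes the parameter of the Gaussian to \<open>\<beta> * (b\<^sub>0 / 2)\<^sup>2\<close>. Cutting it into \<open>q ^ n\<close> cells of side at
  least \<open>2 * d\<close> and taking a point of \<open>X\<close> from each gives a net of mesh \<open>2 / q\<close> on which \<open>g\<close> vanishes.\<close>

lemma cube_error_bound:
  fixes g :: "real ^ 'n \<Rightarrow> complex" and E :: "(real ^ 'n) set"
  assumes \<beta>: "\<beta> > 0" and h: "h = (\<lambda>x. exp (- \<beta> * (norm x)\<^sup>2))"
    and b0: "b\<^sub>0 > 0" and E: "E \<in> cubes b" "b \<ge> b\<^sub>0"
    and g: "continuous_on UNIV g" "native_bound h g N" "\<And>x. x \<in> X \<Longrightarrow> g x = 0"
    and X: "\<And>Q. Q \<in> cubes (2 * d) \<Longrightarrow> Q \<subseteq> E \<Longrightarrow> Q \<inter> X \<noteq> {}"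
    and d: "d > 0" and q: "q > 0" "2 * d * real q \<le> b\<^sub>0" and x: "x \<in> E" and k: "k > 0" and A: "A \<ge> 0"
    and norming: "\<And>Y B (p :: real ^ 'n \<Rightarrow> real) u. cube_net Y (2 / real q) \<Longrightarrow> line_poly k p \<Longrightarrow>
      continuous_on UNIV p \<Longrightarrow> (\<And>y. y \<in> Y \<Longrightarrow> \<bar>p y\<bar> \<le> B) \<Longrightarrow> u \<in> unit_cube \<Longrightarrow> \<bar>p u\<bar> \<le> A * B"
  defines "T \<equiv> 2 * (\<beta> * (b\<^sub>0 / 2)\<^sup>2) * real CARD('n)"
  shows "cmod (g x) \<le> N * sqrt (T ^ k / fact k * exp T) * (1 + sqrt (real (q ^ CARD('n))) * A)"
proof -
  obtain a R where E_eq: "E = (\<lambda>x. a + R *v x) ` cbox 0 (\<chi> i. b)" and R: "rotation_matrix R"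
    using E(1) by (auto simp: cubes_def)
  obtain z where z: "x = a + R *v z" "z \<in> cbox 0 (\<chi> i. b)" using x E_eq by auto
  have zi: "0 \<le> z $ i" "z $ i \<le> b" for i using z(2) by (auto simp: mem_box_cart)
  \<comment> \<open>The corner of a subcube of side \<open>b\<^sub>0\<close> that contains \<open>z\<close> and stays in \<open>[0, b] ^ n\<close>.\<close>
  define z0 where "z0 = (\<chi> i. max 0 (z $ i - b\<^sub>0))"
  have z0: "0 \<le> z0 $ i" "z0 $ i \<le> z $ i" "z $ i \<le> z0 $ i + b\<^sub>0" "z0 $ i + b\<^sub>0 \<le> b" for i
    using zi[of i] E(2) b0 by (auto simp: z0_def)
  define \<Psi> where "\<Psi> = (\<lambda>u. a + R *v (z0 + (b\<^sub>0 / 2) *\<^sub>R (u + 1)))"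
  have dist_\<Psi>: "norm (\<Psi> u - \<Psi> v) = b\<^sub>0 / 2 * norm (u - v)" for u v
  proof -
    have "\<Psi> u - \<Psi> v = R *v ((b\<^sub>0 / 2) *\<^sub>R (u - v))"
      unfolding \<Psi>_def add_diff_cancel_left matrix_vector_mult_diff_distrib[symmetric]
      by (simp add: scaleR_right_diff_distrib[symmetric])
    then show ?thesis using b0 by (simp add: norm_rotation[OF R])
  qed
  have inj: "inj \<Psi>"
    using dist_\<Psi> b0 by (intro injI) (metis divide_pos_pos eq_iff_diff_eq_0 mult_eq_0_iff norm_eq_zero order_less_irrefl zero_less_numeral)
  define G where "G = (\<lambda>u. g (\<Psi> u))"
  define b' where "b' = \<beta> * (b\<^sub>0 / 2)\<^sup>2"
  have hcont: "continuous_on UNIV h" unfolding h by (intro continuous_intros)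
  have h1: "\<bar>h x\<bar> \<le> 1" for x unfolding h using \<beta> by simp
  have h\<Psi>: "h (\<Psi> u - \<Psi> v) = exp (- b' * (norm (u - v))\<^sup>2)" for u v
    unfolding h dist_\<Psi> b'_def by (simp only: power_mult_distrib mult_minus_left mult.assoc)
  have ev: "cmod (\<Sum>u\<in>F. of_real (l u) * G u)
      \<le> N * sqrt (\<Sum>u\<in>F. \<Sum>v\<in>F. l u * l v * exp (- b' * (norm (u - v))\<^sup>2))" if F: "finite F" for F l
  proof -
    define l' where "l' = (\<lambda>x. l (inv \<Psi> x))"
    have l': "l' (\<Psi> u) = l u" for u by (simp add: l'_def inv_f_f[OF inj])
    have injF: "inj_on \<Psi> F" using inj inj_on_subset by blast
    show ?thesis
      using native_bound_point_evaluations[OF hcont h1 g(1,2) finite_imageI[OF F, of \<Psi>], of l']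
      by (simp only: sum.reindex[OF injF] comp_def l' h\<Psi> G_def)
  qed
  have cell: "\<exists>y. \<Psi> y \<in> X \<and> (\<forall>i. - 1 + 2 * real (j i) / real q \<le> y $ i \<and> y $ i \<le> - 1 + 2 * (real (j i) + 1) / real q)"
    if j: "\<And>i. j i < q" for j :: "'n \<Rightarrow> nat"
  proof -
    define s where "s = z0 + (\<chi> i. b\<^sub>0 / real q * real (j i))"
    define Q where "Q = (\<lambda>w. (a + R *v s) + R *v w) ` cbox 0 (\<chi> i. 2 * d)"
    have side: "2 * d \<le> b\<^sub>0 / real q" using q by (simp add: field_simps)
    have "Q \<in> cubes (2 * d)" unfolding Q_def cubes_def using R by blast
    moreover have "Q \<subseteq> E"
    proof
      fix y assume "y \<in> Q"
      then obtain w where w: "y = a + R *v (s + w)" "w \<in> cbox 0 (\<chi> i. 2 * d)"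
        unfolding Q_def by (auto simp: matrix_vector_right_distrib add.assoc)
      have "0 \<le> (s + w) $ i \<and> (s + w) $ i \<le> b" for i
      proof -
        have wi: "0 \<le> w $ i" "w $ i \<le> 2 * d" using w(2) by (auto simp: mem_box_cart)
        have "b\<^sub>0 / real q * real (j i) + b\<^sub>0 / real q = b\<^sub>0 / real q * (real (j i) + 1)" by (simp add: distrib_left)
        also have "\<dots> \<le> b\<^sub>0 / real q * real q" using j[of i] b0 by (intro mult_left_mono) auto
        also have "\<dots> = b\<^sub>0" using q by simp
        finally have "b\<^sub>0 / real q * real (j i) + 2 * d \<le> b\<^sub>0" using side by linarith
        moreover have "0 \<le> b\<^sub>0 / real q * real (j i)" using b0 by simp
        ultimately show ?thesis using wi z0(1)[of i] z0(4)[of i] by (simp add: s_def)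
      qed
      then show "y \<in> E" unfolding E_eq w by (intro imageI) (simp add: mem_box_cart)
    qed
    ultimately obtain y' where y': "y' \<in> Q" "y' \<in> X" using X by blast
    then obtain w where w: "y' = a + R *v (s + w)" "w \<in> cbox 0 (\<chi> i. 2 * d)"
      unfolding Q_def by (auto simp: matrix_vector_right_distrib add.assoc)
    define y where "y = (2 / b\<^sub>0) *\<^sub>R ((\<chi> i. b\<^sub>0 / real q * real (j i)) + w) - 1"
    have "\<Psi> y = y'" unfolding \<Psi>_def y_def w s_def using b0 by (simp add: add.assoc)
    moreover have "- 1 + 2 * real (j i) / real q \<le> y $ i \<and> y $ i \<le> - 1 + 2 * (real (j i) + 1) / real q" for i
    proof -
      have wi: "0 \<le> w $ i" "w $ i \<le> b\<^sub>0 / real q" using w(2) side by (auto simp: mem_box_cart intro: order_trans)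
      have "y $ i = - 1 + 2 * real (j i) / real q + 2 / b\<^sub>0 * w $ i"
        using b0 by (simp add: y_def distrib_left)
      moreover have "0 \<le> 2 / b\<^sub>0 * w $ i" using wi b0 by simp
      moreover have "2 / b\<^sub>0 * w $ i \<le> 2 / b\<^sub>0 * (b\<^sub>0 / real q)" using wi b0 by (intro mult_left_mono) auto
      moreover have "2 / b\<^sub>0 * (b\<^sub>0 / real q) = 2 / real q" using b0 by simp
      moreover have "2 * (real (j i) + 1) / real q = 2 * real (j i) / real q + 2 / real q"
        by (simp add: add_divide_distrib)
      ultimately show ?thesis by linarith
    qed
    ultimately show ?thesis using y'(2) by blast
  qed
  define J where "J = PiE (UNIV :: 'n set) (\<lambda>_. {..<q})"
  have J: "finite J" "card J = q ^ CARD('n)" unfolding J_def by (simp_all add: finite_PiE card_PiE)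
  have "\<forall>j\<in>J. \<exists>y. \<Psi> y \<in> X \<and> (\<forall>i. - 1 + 2 * real (j i) / real q \<le> y $ i \<and> y $ i \<le> - 1 + 2 * (real (j i) + 1) / real q)"
    using cell by (auto simp: J_def)
  from bchoice[OF this] obtain yy where yX: "\<And>j. j \<in> J \<Longrightarrow> \<Psi> (yy j) \<in> X"
    and y_lo: "\<And>j i. j \<in> J \<Longrightarrow> - 1 + 2 * real (j i) / real q \<le> yy j $ i"
    and y_hi: "\<And>j i. j \<in> J \<Longrightarrow> yy j $ i \<le> - 1 + 2 * (real (j i) + 1) / real q" by blast
  define Y where "Y = yy ` J"
  have Y: "finite Y" "card Y \<le> q ^ CARD('n)" unfolding Y_def using J card_image_le[OF J(1)] by auto
  have net: "cube_net Y (2 / real q)"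
    unfolding cube_net_def
  proof (intro conjI subsetI ballI)
    fix y assume "y \<in> Y"
    then obtain j where j: "j \<in> J" "y = yy j" by (auto simp: Y_def)
    have "\<bar>y $ i\<bar> \<le> 1" for i
    proof -
      have "j i < q" using j by (auto simp: J_def)
      then have "2 * (real (j i) + 1) / real q \<le> 2" using q by (simp add: field_simps)
      moreover have "0 \<le> 2 * real (j i) / real q" by simp
      ultimately show ?thesis using y_lo[OF j(1), of i] y_hi[OF j(1), of i] unfolding j(2) by (intro abs_leI) linarith+
    qed
    then show "y \<in> unit_cube" by (simp add: unit_cube_def)
  next
    fix u :: "real ^ 'n" assume u: "u \<in> unit_cube"
    \<comment> \<open>The minimum puts the faces with coordinate \<open>1\<close> into the last cell.\<close>
    define j where "j = (\<lambda>i. min (nat \<lfloor>(u $ i + 1) * real q / 2\<rfloor>) (q - 1))"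
    have jJ: "j \<in> J" using q by (auto simp: J_def j_def)
    have ji: "2 * real (j i) / real q \<le> u $ i + 1 \<and> u $ i + 1 \<le> 2 * (real (j i) + 1) / real q" for i
    proof -
      define t where "t = (u $ i + 1) * real q / 2"
      have ui: "-1 \<le> u $ i" "u $ i \<le> 1" using u by (auto simp: unit_cube_def abs_le_iff minus_le_iff)
      have t0: "0 \<le> t" using ui by (simp add: t_def)
      have "(u $ i + 1) * real q \<le> 2 * real q" using ui by (intro mult_right_mono) auto
      then have tq: "t \<le> real q" by (simp add: t_def)
      have fl: "real (nat \<lfloor>t\<rfloor>) \<le> t" "t < real (nat \<lfloor>t\<rfloor>) + 1" using t0 by linarith+
      have "real (j i) \<le> t \<and> t \<le> real (j i) + 1"
      proof (cases "nat \<lfloor>t\<rfloor> \<le> q - 1")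
        case True
        then show ?thesis using fl by (simp add: j_def t_def[symmetric])
      next
        case False
        then have "j i = q - 1" "real (q - 1) = real q - 1" using q by (auto simp: j_def t_def[symmetric])
        moreover have "real q \<le> real (nat \<lfloor>t\<rfloor>)" using False by linarith
        ultimately show ?thesis using fl tq by linarith
      qed
      then show ?thesis using q by (simp add: t_def field_simps)
    qed
    show "\<exists>y\<in>Y. \<forall>i. \<bar>y $ i - u $ i\<bar> \<le> 2 / real q"
    proof (intro bexI allI)
      show "yy j \<in> Y" using jJ by (simp add: Y_def)
      fix i
      have "2 * (real (j i) + 1) / real q = 2 * real (j i) / real q + 2 / real q"
        by (simp add: add_divide_distrib)
      then show "\<bar>yy j $ i - u $ i\<bar> \<le> 2 / real q"
        using ji[of i] y_lo[OF jJ, of i] y_hi[OF jJ, of i] by (auto simp: abs_le_iff)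
    qed
  qed
  define u where "u = (2 / b\<^sub>0) *\<^sub>R (z - z0) - 1"
  have \<Psi>u: "\<Psi> u = x" unfolding \<Psi>_def u_def z(1) using b0 by simp
  have "\<bar>u $ i\<bar> \<le> 1" for i
  proof -
    have "u $ i = 2 / b\<^sub>0 * (z $ i - z0 $ i) - 1" by (simp add: u_def)
    moreover have "2 / b\<^sub>0 * (z $ i - z0 $ i) \<le> 2 / b\<^sub>0 * b\<^sub>0" using z0(3)[of i] b0 by (intro mult_left_mono) auto
    moreover have "2 / b\<^sub>0 * b\<^sub>0 = 2" using b0 by simp
    moreover have "0 \<le> 2 / b\<^sub>0 * (z $ i - z0 $ i)" using z0(2)[of i] b0 by simp
    ultimately show ?thesis by linarith
  qed
  then have u: "u \<in> unit_cube" by (simp add: unit_cube_def)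
  have N0: "N \<ge> 0" using g(2) by (simp add: native_bound_def)
  have b'0: "b' \<ge> 0" using \<beta> by (simp add: b'_def)
  have T: "T = 2 * b' * real CARD('n)" by (simp add: T_def b'_def)
  have "cmod (G u) \<le> N * sqrt (T ^ k / fact k * exp T) * (1 + sqrt (real (card Y)) * A)"
    unfolding T
  proof (rule gaussian_zero_set_bound[OF b'0 N0 k A ev Y(1)])
    show "Y \<subseteq> unit_cube" using net by (simp add: cube_net_def)
    show "G y = 0" if "y \<in> Y" for y using that yX g(3) by (auto simp: Y_def G_def)
  qed (use u norming[OF net] in auto)
  also have "\<dots> \<le> N * sqrt (T ^ k / fact k * exp T) * (1 + sqrt (real (q ^ CARD('n))) * A)"
  proof (rule mult_left_mono)
    have "sqrt (real (card Y)) \<le> sqrt (real (q ^ CARD('n)))" using Y(2) by (simp only: real_sqrt_le_iff of_nat_le_iff)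
    then show "1 + sqrt (real (card Y)) * A \<le> 1 + sqrt (real (q ^ CARD('n))) * A"
      using A by (intro add_left_mono mult_right_mono)
    show "0 \<le> N * sqrt (T ^ k / fact k * exp T)" using N0 b'0 by (simp add: T)
  qed
  finally show ?thesis by (simp add: G_def \<Psi>u)
qed

theorem mainTheorem2:
  fixes \<beta> b\<^sub>0 \<rho> c C C' c' \<Delta> \<gamma> \<alpha> :: real
    and n :: nat
    and h :: "real ^ 'n \<Rightarrow> real"
    and \<Omega> :: "(real ^ 'n) set"
    and \<Q> :: "(real ^ 'n) set set"
  assumes n: "n = CARD('n)"
    and beta: "\<beta> > 0"
    and h: "h = (\<lambda>x. exp (- \<beta> * (norm x)\<^sup>2))"
    and b0: "b\<^sub>0 > 0"
    and Omega: "\<Q> \<subseteq> cubes b\<^sub>0" "\<Omega> = \<Union>\<Q>"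
    and gamma: "\<gamma> = gamma_seq n"
    and alpha: "\<alpha> = measure lborel (ball (0 :: real ^ 'n) 1)"
    and rho: "\<rho> = sqrt 3 / exp 1"
    and c: "c = b\<^sub>0 / (8 * \<gamma>)"
    and C: "C = (3 powr (3 / 4) * exp 1 * sqrt (2 * \<rho> * \<beta>) * sqrt (real n)
                  * exp (2 * real n * \<gamma>)) ^ 4 * b\<^sub>0 ^ 3 * \<gamma>"
    and C': "C' = 2 * C"
    and c': "c' = c / 2"
    and Delta: "\<Delta> =
      (if even n
       then pi powr ((real n - 1) / 4) * (real n * \<alpha>) powr (1 / 2)
            * 2 powr ((real n + 1) / 4) * (sqrt 3 / exp 1) powr ((real n - 2) / 4)
       else pi powr ((real n - 1) / 4) * (real n * \<alpha>) powr (1 / 2)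
            * (2 + 1 / exp 1) powr (1 / 2)
            * 2 powr (real n / 4) * (sqrt 3 / exp 1) powr ((real n - 1) / 4))"
  shows "\<exists>d\<^sub>0 > 0. \<forall>f s X E b d.
           f \<in> native_space h \<longrightarrow> is_spline h X f s \<longrightarrow>
           E \<in> cubes b \<longrightarrow> E \<subseteq> \<Omega> \<longrightarrow> b \<ge> b\<^sub>0 \<longrightarrow>
           (ennreal d = fill_distance \<Omega> X \<or> ennreal d = fill_distance E X) \<longrightarrow>
           0 < d \<longrightarrow> d \<le> d\<^sub>0 \<longrightarrow>
           (\<forall>Q \<in> cubes (2 * d). Q \<subseteq> E \<longrightarrow> Q \<inter> X \<noteq> {}) \<longrightarrow>
           (\<forall>x\<in>E. cmod (f x - s x) \<le> \<Delta> * (C' * d) powr (c' / d) * native_norm h f)"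
proof -
  have n1: "n \<ge> 1" using n zero_less_card_finite[where 'a = 'n] by simp
  have \<gamma>2: "\<gamma> \<ge> 2"
  proof (cases "n \<ge> 2")
    case True then show ?thesis using gamma_seq_ge[OF True] by (simp add: gamma)
  next
    case False
    then have "n = 1" using n1 by simp
    then show ?thesis by (simp add: gamma)
  qed
  obtain A :: real where A1: "A \<ge> 1" and norming:
    "\<And>k q Y B (p :: real ^ 'n \<Rightarrow> real) u. k \<ge> 10 \<Longrightarrow> 3 * \<gamma> * real k \<le> q \<Longrightarrow> q \<le> 6 * \<gamma> * real k \<Longrightarrow>
      cube_net Y (2 / q) \<Longrightarrow> line_poly k p \<Longrightarrow> continuous_on UNIV p \<Longrightarrow>
      (\<And>y. y \<in> Y \<Longrightarrow> \<bar>p y\<bar> \<le> B) \<Longrightarrow> u \<in> unit_cube \<Longrightarrow> \<bar>p u\<bar> \<le> A ^ k * B"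
    unfolding gamma n by (rule norming_constant) blast
  define \<eta> where "\<eta> = b\<^sub>0 / (6 * \<gamma>)"
  define T where "T = 2 * (\<beta> * (b\<^sub>0 / 2)\<^sup>2) * real CARD('n)"
  define L where "L = max 1 (sqrt T * exp (6 * \<gamma> * real n) * A)"
  define K where "K = 4 * sqrt (exp T)"
  have \<eta>: "\<eta> > 0" using b0 \<gamma>2 by (simp add: \<eta>_def)
  have T0: "T \<ge> 0" using beta by (simp add: T_def)
  have L1: "L \<ge> 1" by (simp add: L_def)
  have K0: "K > 0" by (simp add: K_def)
  have C'0: "C' > 0" unfolding C' C rho using beta b0 \<gamma>2 n1 by simp
  have \<Delta>0: "\<Delta> > 0"
  proof -
    have "\<alpha> > 0" unfolding alpha by (rule content_ball_pos) simp
    then have "real n * \<alpha> \<noteq> 0" using n1 by simp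
    moreover have "2 + 1 / exp 1 \<noteq> (0::real)"
      using add_pos_pos[of 2 "1 / exp 1 :: real"] by simp
    moreover have "sqrt 3 / exp 1 \<noteq> (0::real)" by simp
    ultimately show ?thesis unfolding Delta
      by (simp only: split: if_split) (intro conjI impI mult_pos_pos powr_gt_zero[THEN iffD2]; simp)
  qed
  \<comment> \<open>\<open>c'\<close> equals \<open>b\<^sub>0 / (16 * \<gamma>)\<close>, against \<open>\<eta> / 2 = b\<^sub>0 / (12 * \<gamma>)\<close>.\<close>
  have rate: "c' < 9 / 20 * \<eta>" unfolding c' c \<eta>_def using b0 \<gamma>2 by (simp add: field_simps)
  obtain d\<^sub>1 where d1: "d\<^sub>1 > 0" and decay: "\<And>d k. 0 < d \<Longrightarrow> d \<le> d\<^sub>1 \<Longrightarrow> real k \<le> \<eta> / d \<Longrightarrow> \<eta> / d - 2 \<le> real k \<Longrightarrow>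
      K * L ^ k / sqrt (fact k) \<le> \<Delta> * (C' * d) powr (c' / d)"
    using superexponential_decay[OF \<eta> C'0 \<Delta>0 K0 L1 rate] by blast
  have main: "cmod (f x - s x) \<le> \<Delta> * (C' * d) powr (c' / d) * native_norm h f"
    if f: "f \<in> native_space h" and s: "is_spline h X f s" and E: "E \<in> cubes b" "b\<^sub>0 \<le> b"
      and d: "0 < d" "d \<le> min d\<^sub>1 (\<eta> / 12)"
      and X: "\<forall>Q\<in>cubes (2 * d). Q \<subseteq> E \<longrightarrow> Q \<inter> X \<noteq> {}" and x: "x \<in> E" for f s X E b d x
  proof -
    define q where "q = nat \<lfloor>b\<^sub>0 / (2 * d)\<rfloor>"
    define k where "k = nat \<lfloor>real q / (3 * \<gamma>)\<rfloor>"
    have "0 \<le> b\<^sub>0 / (2 * d)" using b0 d by simp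
    then have q: "real q \<le> b\<^sub>0 / (2 * d)" "b\<^sub>0 / (2 * d) < real q + 1" unfolding q_def by linarith+
    have "0 \<le> real q / (3 * \<gamma>)" using \<gamma>2 by simp
    then have k: "real k \<le> real q / (3 * \<gamma>)" "real q / (3 * \<gamma>) < real k + 1" unfolding k_def by linarith+
    have \<eta>d: "\<eta> / d = b\<^sub>0 / (2 * d) / (3 * \<gamma>)" by (simp add: \<eta>_def)
    have k_up: "real k \<le> \<eta> / d"
    proof -
      have "real q / (3 * \<gamma>) \<le> b\<^sub>0 / (2 * d) / (3 * \<gamma>)" using q \<gamma>2 by (intro divide_right_mono) auto
      then show ?thesis using k \<eta>d by linarith
    qed
    have k_lo: "\<eta> / d - 2 \<le> real k"
    proof -
      have "b\<^sub>0 / (2 * d) / (3 * \<gamma>) \<le> (real q + 1) / (3 * \<gamma>)" using q \<gamma>2 by (intro divide_right_mono) auto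
      also have "\<dots> = real q / (3 * \<gamma>) + 1 / (3 * \<gamma>)" by (rule add_divide_distrib)
      also have "1 / (3 * \<gamma>) \<le> 1" using \<gamma>2 by simp
      finally show ?thesis using k \<eta>d by linarith
    qed
    have "12 \<le> \<eta> / d" using d by (simp add: field_simps)
    then have k10: "k \<ge> 10" using k_lo by linarith
    have qk: "3 * \<gamma> * real k \<le> real q" "real q \<le> 6 * \<gamma> * real k"
    proof -
      show "3 * \<gamma> * real k \<le> real q" using k(1) \<gamma>2 by (simp add: field_simps)
      have "real q \<le> 3 * \<gamma> * (real k + 1)" using k(2) \<gamma>2 by (simp add: field_simps)
      also have "\<dots> \<le> 3 * \<gamma> * (2 * real k)" using k10 \<gamma>2 by (intro mult_left_mono) auto
      finally show "real q \<le> 6 * \<gamma> * real k" by simp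
    qed
    have "0 < 3 * \<gamma> * real k" using \<gamma>2 k10 by simp
    then have q0: "q > 0" using qk(1) by linarith
    obtain N where N: "native_bound h (\<lambda>x. f x - s x) N" "N \<le> 2 * native_norm h f"
      using native_bound_spline_error[OF f s] .
    have Nf: "native_norm h f \<ge> 0"
      using native_bound_native_norm[OF f] by (simp add: native_bound_def)
    have "cmod (f x - s x) \<le> N * sqrt (T ^ k / fact k * exp T) * (1 + sqrt (real (q ^ CARD('n))) * A ^ k)"
      unfolding T_def
    proof (rule cube_error_bound[OF beta h b0 E _ N(1)])
      show "continuous_on UNIV (\<lambda>x. f x - s x)"
        using f s by (intro continuous_intros) (auto simp: native_space_def is_spline_def)
      show "f y - s y = 0" if "y \<in> X" for y using s that by (simp add: is_spline_def)
      show "2 * d * real q \<le> b\<^sub>0" using q(1) d by (simp add: field_simps)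
      show "\<bar>p u\<bar> \<le> A ^ k * B"
        if "cube_net Y (2 / real q)" "line_poly k p" "continuous_on UNIV p" "\<And>y. y \<in> Y \<Longrightarrow> \<bar>p y\<bar> \<le> B"
          "u \<in> unit_cube" for Y B and p :: "real ^ 'n \<Rightarrow> real" and u
        by (rule norming[OF k10 qk that])
    qed (use X d q0 k10 x A1 in auto)
    also have "\<dots> \<le> (2 * native_norm h f) * sqrt (T ^ k / fact k * exp T) * (1 + sqrt (real (q ^ CARD('n))) * A ^ k)"
      using N(2) T0 A1 by (intro mult_right_mono) auto
    also have "\<dots> \<le> (2 * native_norm h f) * sqrt (T ^ k / fact k * exp T) * (2 * (exp (6 * \<gamma> * real n) * A) ^ k)"
    proof (rule mult_left_mono)
      have "real q \<le> exp (real q)" using exp_ge_add_one_self[of "real q"] by linarith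
      then have "real q ^ n \<le> exp (real q) ^ n" by (intro power_mono) auto
      also have "\<dots> = exp (real n * real q)" by (simp add: exp_of_nat_mult)
      also have "\<dots> \<le> exp (real n * (6 * \<gamma> * real k))" using qk by (simp add: mult_left_mono)
      also have "\<dots> = exp (6 * \<gamma> * real n) ^ k" by (simp add: mult_ac flip: exp_of_nat_mult)
      finally have q_le: "real q ^ n \<le> exp (6 * \<gamma> * real n) ^ k" .
      have q1: "1 \<le> real q ^ n" using q0 by (intro one_le_power) simp
      have "sqrt (real q ^ n) \<le> real q ^ n"
        using q1 mult_left_mono[OF q1, of "real q ^ n"] by (intro real_le_lsqrt) (auto simp: power2_eq_square)
      then have "sqrt (real (q ^ CARD('n))) * A ^ k \<le> exp (6 * \<gamma> * real n) ^ k * A ^ k"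
        using q_le A1 by (intro mult_right_mono) (auto simp: n)
      moreover have "1 * 1 \<le> exp (6 * \<gamma> * real n) ^ k * A ^ k"
      proof (rule mult_mono)
        show "1 \<le> exp (6 * \<gamma> * real n) ^ k" using q1 q_le by linarith
        show "1 \<le> A ^ k" using A1 by (rule one_le_power)
      qed simp_all
      ultimately show "1 + sqrt (real (q ^ CARD('n))) * A ^ k \<le> 2 * (exp (6 * \<gamma> * real n) * A) ^ k"
        by (simp add: power_mult_distrib)
      show "0 \<le> 2 * native_norm h f * sqrt (T ^ k / fact k * exp T)" using Nf T0 by simp
    qed
    also have "\<dots> = K * (sqrt T * exp (6 * \<gamma> * real n) * A) ^ k / sqrt (fact k) * native_norm h f"
      unfolding K_def power_mult_distrib by (simp add: real_sqrt_mult real_sqrt_divide real_sqrt_power mult_ac)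
    also have "\<dots> \<le> K * L ^ k / sqrt (fact k) * native_norm h f"
      using K0 Nf T0 A1 unfolding L_def
      by (intro mult_right_mono divide_right_mono mult_left_mono power_mono) auto
    also have "\<dots> \<le> \<Delta> * (C' * d) powr (c' / d) * native_norm h f"
      using d Nf by (intro mult_right_mono decay k_up k_lo) auto
    finally show ?thesis .
  qed
  show ?thesis
  proof (intro exI conjI allI impI ballI)
    show "min d\<^sub>1 (\<eta> / 12) > 0" using d1 \<eta> by simp
  qed (rule main)
qed

end
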